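(* Let $\mathcal{H}$ be a Hopf algebra with bijective antipode over a field $k$ of characteristic zero, let $A$ be a Yetter-Drinfeld $\mathcal{H}$-algebra, and let $V$ be a representation of $\mathcal{H}$. Then there is an isomorphism of $\mathcal{H}$-algebras (an $\mathcal{H}$-linear algebra isomorphism) between $A\,\bar\otimes\,\mathrm{End}(V)$ and $A\otimes\mathrm{End}(V)$, where $A\,\bar\otimes\,\mathrm{End}(V)$ denotes the vector space $A\otimes\mathrm{End}(V)$ with the structure $$(a\otimes u)(b\otimes v)=ab\otimes uv,\qquad h\cdot(a\otimes u)=h^{(1)}\cdot a\otimes h^{(0)}uS(h^{(2)}),$$ and $A\otimes\mathrm{End}(V)$ denotes the same vector space with the structure $$(a\otimes u)(c\otimes v)=ac_{<0>}\otimes(c_{<1>}\cdot u)v,\qquad h\cdot(a\otimes u)=h^{(0)}\cdot a\otimes h^{(1)}\cdot u .$$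
   Context: Sweedler notation: $\Delta h=h^{(0)}\otimes h^{(1)}$, $\Delta^{(n)}h=h^{(0)}\otimes\cdots\otimes h^{(n)}$; $S,\epsilon$ are antipode and counit. Algebras are unital. A left $\mathcal{H}$-algebra is an algebra $A$ that is a left $\mathcal{H}$-module with $h\cdot(ab)=(h^{(0)}\cdot a)(h^{(1)}\cdot b)$, $h\cdot1=\epsilon(h)1$. A Yetter-Drinfeld $\mathcal{H}$-algebra is an algebra $A$ that is (1) a left $\mathcal{H}$-algebra; (2) a right $\mathcal{H}^{op}$-comodule algebra, i.e. there is a right coaction $\rho:A\to A\otimes\mathcal{H}$, $\rho(a)=a_{<0>}\otimes a_{<1>}$, with $\rho(ab)=a_{<0>}b_{<0>}\otimes b_{<1>}a_{<1>}$ and $\rho(1)=1\otimes1$; (3) satisfying $(h^{(1)}\cdot a)_{<0>}\otimes(h^{(1)}\cdot a)_{<1>}h^{(0)}=h^{(0)}\cdot a_{<0>}\otimes h^{(1)}a_{<1>}$ for all $h\in\mathcal{H},a\in A$. Elements of $\mathcal{H}$ also denote the operators by which they act on $V$; $\mathcal{H}$ acts on $\mathrm{End}(V)$ by conjugation, $h\cdot u=h^{(0)}\circ u\circ S(h^{(1)})$. *)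

theory Defs
  imports "HOL-Algebra.Module" "HOL-Algebra.QuotRing"
begin

section \<open>Linear and bilinear maps, unital algebras\<close>

definition linear_map ::
    "('k, 'c) ring_scheme \<Rightarrow> ('k, 'm, 'x) module_scheme \<Rightarrow> ('k, 'n, 'y) module_scheme
      \<Rightarrow> ('m \<Rightarrow> 'n) \<Rightarrow> bool" where
  "linear_map K M N f \<longleftrightarrow>
     f \<in> carrier M \<rightarrow> carrier N \<and>
     (\<forall>x\<in>carrier M. \<forall>y\<in>carrier M. f (x \<oplus>\<^bsub>M\<^esub> y) = f x \<oplus>\<^bsub>N\<^esub> f y) \<and>
     (\<forall>r\<in>carrier K. \<forall>x\<in>carrier M. f (r \<odot>\<^bsub>M\<^esub> x) = r \<odot>\<^bsub>N\<^esub> f x)"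

definition bilinear_map ::
    "('k, 'c) ring_scheme \<Rightarrow> ('k, 'm, 'x) module_scheme \<Rightarrow> ('k, 'n, 'y) module_scheme
      \<Rightarrow> ('k, 'p, 'z) module_scheme \<Rightarrow> ('m \<Rightarrow> 'n \<Rightarrow> 'p) \<Rightarrow> bool" where
  "bilinear_map K M N P f \<longleftrightarrow>
     (\<forall>x\<in>carrier M. linear_map K N P (f x)) \<and>
     (\<forall>y\<in>carrier N. linear_map K M P (\<lambda>x. f x y))"

text \<open>The library locale \<^locale>\<open>algebra\<close> requires commutativity, hence a separate notion.\<close>

locale unital_algebra = module K A + ring A for K (structure) and A (structure) +
  assumes bilinear_mult: "bilinear_map K A A A (\<lambda>x y. x \<otimes>\<^bsub>A\<^esub> y)"

definition algebra_iso ::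
    "('k, 'c) ring_scheme \<Rightarrow> ('k, 'a, 'x) module_scheme \<Rightarrow> ('k, 'b, 'y) module_scheme
      \<Rightarrow> ('a \<Rightarrow> 'b) set" where
  "algebra_iso K A B = {f \<in> ring_iso A B. linear_map K A B f}"


section \<open>The tensor product of modules\<close>

text \<open>
  A list \<open>[(m\<^sub>1, n\<^sub>1), \<dots>, (m\<^sub>r, n\<^sub>r)]\<close> stands for the formal sum
  \<open>m\<^sub>1 \<otimes> n\<^sub>1 + \<dots> + m\<^sub>r \<otimes> n\<^sub>r\<close>.  The tensor product is the free monoid on \<open>M \<times> N\<close> modulo the
  congruence generated by commutativity and the relations making \<open>\<otimes>\<close> bilinear; additive
  inverses come from multiplication by the scalar \<open>-1\<close>.  Lists with entries outside the carriers
  are related to nothing.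
\<close>

inductive tensor_eq ::
    "('k, 'c) ring_scheme \<Rightarrow> ('k, 'm, 'x) module_scheme \<Rightarrow> ('k, 'n, 'y) module_scheme
      \<Rightarrow> ('m \<times> 'n) list \<Rightarrow> ('m \<times> 'n) list \<Rightarrow> bool"
  for K M N where
  refl: "set xs \<subseteq> carrier M \<times> carrier N \<Longrightarrow> tensor_eq K M N xs xs"
| sym: "tensor_eq K M N xs ys \<Longrightarrow> tensor_eq K M N ys xs"
| trans: "tensor_eq K M N xs ys \<Longrightarrow> tensor_eq K M N ys zs \<Longrightarrow> tensor_eq K M N xs zs"
| append: "tensor_eq K M N xs ys \<Longrightarrow> tensor_eq K M N xs' ys'
    \<Longrightarrow> tensor_eq K M N (xs @ xs') (ys @ ys')"
| comm: "set xs \<subseteq> carrier M \<times> carrier N \<Longrightarrow> set ys \<subseteq> carrier M \<times> carrier N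
    \<Longrightarrow> tensor_eq K M N (xs @ ys) (ys @ xs)"
| zero_left: "n \<in> carrier N \<Longrightarrow> tensor_eq K M N [(\<zero>\<^bsub>M\<^esub>, n)] []"
| zero_right: "m \<in> carrier M \<Longrightarrow> tensor_eq K M N [(m, \<zero>\<^bsub>N\<^esub>)] []"
| add_left: "m \<in> carrier M \<Longrightarrow> m' \<in> carrier M \<Longrightarrow> n \<in> carrier N
    \<Longrightarrow> tensor_eq K M N [(m \<oplus>\<^bsub>M\<^esub> m', n)] [(m, n), (m', n)]"
| add_right: "m \<in> carrier M \<Longrightarrow> n \<in> carrier N \<Longrightarrow> n' \<in> carrier N
    \<Longrightarrow> tensor_eq K M N [(m, n \<oplus>\<^bsub>N\<^esub> n')] [(m, n), (m, n')]"
| balanced: "r \<in> carrier K \<Longrightarrow> m \<in> carrier M \<Longrightarrow> n \<in> carrier N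
    \<Longrightarrow> tensor_eq K M N [(r \<odot>\<^bsub>M\<^esub> m, n)] [(m, r \<odot>\<^bsub>N\<^esub> n)]"

definition tensor_class ::
    "('k, 'c) ring_scheme \<Rightarrow> ('k, 'm, 'x) module_scheme \<Rightarrow> ('k, 'n, 'y) module_scheme
      \<Rightarrow> ('m \<times> 'n) list \<Rightarrow> ('m \<times> 'n) list set" where
  "tensor_class K M N xs = {ys. tensor_eq K M N xs ys}"

definition tens ::
    "('k, 'c) ring_scheme \<Rightarrow> ('k, 'm, 'x) module_scheme \<Rightarrow> ('k, 'n, 'y) module_scheme
      \<Rightarrow> 'm \<Rightarrow> 'n \<Rightarrow> ('m \<times> 'n) list set" where
  "tens K M N m n = tensor_class K M N [(m, n)]"

text \<open>Only the module structure is specified; \<^const>\<open>mult\<close> and \<^const>\<open>one\<close> are left open.\<close>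

definition tensor ::
    "('k, 'c) ring_scheme \<Rightarrow> ('k, 'm, 'x) module_scheme \<Rightarrow> ('k, 'n, 'y) module_scheme
      \<Rightarrow> ('k, ('m \<times> 'n) list set) module" where
  "tensor K M N =
    \<lparr> carrier = tensor_class K M N ` lists (carrier M \<times> carrier N),
      mult = undefined,
      one = undefined,
      zero = tensor_class K M N [],
      add = (\<lambda>X Y. \<Union>xs\<in>X. \<Union>ys\<in>Y. tensor_class K M N (xs @ ys)),
      smult = (\<lambda>r X. \<Union>xs\<in>X. tensor_class K M N (map (\<lambda>(m, n). (r \<odot>\<^bsub>M\<^esub> m, n)) xs)) \<rparr>"

text \<open>
  The linear map on a tensor product induced by a bilinear map \<open>f\<close> into \<open>P\<close>, evaluated on a
  representative.  This renders Sweedler notation: if \<open>X = x\<^sub>0 \<otimes> x\<^sub>1\<close> (summation understood)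
  then \<open>tlift P f X\<close> is \<open>f x\<^sub>0 x\<^sub>1\<close>.
\<close>

definition tlift ::
    "('k, 'p, 'z) module_scheme \<Rightarrow> ('m \<Rightarrow> 'n \<Rightarrow> 'p) \<Rightarrow> ('m \<times> 'n) list set \<Rightarrow> 'p" where
  "tlift P f X = foldr (\<lambda>(m, n) s. f m n \<oplus>\<^bsub>P\<^esub> s) (SOME xs. xs \<in> X) \<zero>\<^bsub>P\<^esub>"

subsection \<open>The universal property\<close>

lemma tensor_eq_carrier:
  assumes "module K M" "module K N" "tensor_eq K M N xs ys"
  shows "set xs \<subseteq> carrier M \<times> carrier N \<and> set ys \<subseteq> carrier M \<times> carrier N"
proof -
  interpret M: module K M by fact
  interpret N: module K N by fact
  show ?thesis using assms(3) by induction auto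
qed

lemma linear_mapD:
  assumes "linear_map K M N f"
  shows "x \<in> carrier M \<Longrightarrow> f x \<in> carrier N"
    and "x \<in> carrier M \<Longrightarrow> y \<in> carrier M \<Longrightarrow> f (x \<oplus>\<^bsub>M\<^esub> y) = f x \<oplus>\<^bsub>N\<^esub> f y"
    and "r \<in> carrier K \<Longrightarrow> x \<in> carrier M \<Longrightarrow> f (r \<odot>\<^bsub>M\<^esub> x) = r \<odot>\<^bsub>N\<^esub> f x"
  using assms by (auto simp: linear_map_def)

lemma linear_map_zero:
  assumes "module K M" "module K N" "linear_map K M N f"
  shows "f \<zero>\<^bsub>M\<^esub> = \<zero>\<^bsub>N\<^esub>"
proof -
  interpret M: module K M by fact
  interpret N: module K N by fact
  have "f (\<zero>\<^bsub>K\<^esub> \<odot>\<^bsub>M\<^esub> \<zero>\<^bsub>M\<^esub>) = \<zero>\<^bsub>K\<^esub> \<odot>\<^bsub>N\<^esub> f \<zero>\<^bsub>M\<^esub>"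
    by (rule linear_mapD(3)[OF assms(3)]) auto
  then show ?thesis using linear_mapD(1)[OF assms(3) M.zero_closed] by simp
qed

definition tsum where "tsum P f xs = foldr (\<lambda>(m, n) s. f m n \<oplus>\<^bsub>P\<^esub> s) xs \<zero>\<^bsub>P\<^esub>"

lemma tsum_simps [simp]: "tsum P f [] = \<zero>\<^bsub>P\<^esub>" "tsum P f (x # xs) = f (fst x) (snd x) \<oplus>\<^bsub>P\<^esub> tsum P f xs"
  by (auto simp: tsum_def split: prod.split)

context
  fixes K :: "('k,'c) ring_scheme" and M :: "('k,'m,'x) module_scheme" and N :: "('k,'n,'y) module_scheme"
  assumes M: "module K M" and N: "module K N"
begin
interpretation M: module K M by (rule M)
interpretation N: module K N by (rule N)

lemma tsum_closed:
  assumes "module K P" "bilinear_map K M N P f"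
  shows "set xs \<subseteq> carrier M \<times> carrier N \<Longrightarrow> tsum P f xs \<in> carrier P"
proof -
  interpret P: module K P by fact
  show "set xs \<subseteq> carrier M \<times> carrier N \<Longrightarrow> tsum P f xs \<in> carrier P"
  using assms(2) by (induction xs) (auto simp: bilinear_map_def dest!: linear_mapD(1))
qed

lemma tsum_append:
  assumes "module K P" "bilinear_map K M N P f"
  shows "set xs \<subseteq> carrier M \<times> carrier N \<Longrightarrow> set ys \<subseteq> carrier M \<times> carrier N \<Longrightarrow> tsum P f (xs @ ys) = tsum P f xs \<oplus>\<^bsub>P\<^esub> tsum P f ys"
proof (induction xs)
  interpret P: module K P by fact
  case Nil then show ?case using tsum_closed[OF assms] by simp
next
  interpret P: module K P by fact
  case (Cons x xs)
  have 1: "f (fst x) (snd x) \<in> carrier P" using Cons.prems assms(2) by (cases x) (auto simp: bilinear_map_def dest!: linear_mapD(1))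
  show ?case using 1 Cons tsum_closed[OF assms, of xs] tsum_closed[OF assms, of ys]
    by (simp add: P.M.a_assoc)
qed

lemma tsum_eq:
  assumes P: "module K P" and f: "bilinear_map K M N P f" and "tensor_eq K M N xs ys"
  shows "tsum P f xs = tsum P f ys"
proof -
  interpret P: module K P by fact
  have c: "m \<in> carrier M \<Longrightarrow> n \<in> carrier N \<Longrightarrow> f m n \<in> carrier P" for m n
    using f by (auto simp: bilinear_map_def linear_map_def)
  note cc = tensor_eq_carrier[OF M N]
  show ?thesis using assms(3)
  proof induction
    case (append xs ys xs' ys')
    then show ?case using cc[OF append(1)] cc[OF append(2)] tsum_append[OF P f] by simp
  next
    case (comm xs ys)
    then show ?case using tsum_append[OF P f] tsum_closed[OF P f] P.M.a_comm by simp
  next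
    case (zero_left n)
    then show ?case using linear_map_zero[OF M P, of "\<lambda>x. f x n"] f by (simp add: bilinear_map_def)
  next
    case (zero_right n)
    then show ?case using linear_map_zero[OF N P, of "f n"] f by (simp add: bilinear_map_def)
  next
    case (add_left m m' n)
    then show ?case using linear_mapD(2)[of K M P "\<lambda>x. f x n" m m'] f c by (simp add: bilinear_map_def P.M.a_assoc)
  next
    case (add_right m n n')
    then show ?case using linear_mapD(2)[of K N P "f m" n n'] f c by (simp add: bilinear_map_def P.M.a_assoc)
  next
    case (balanced r m n)
    then show ?case using linear_mapD(3)[of K N P "f m" r n] linear_mapD(3)[of K M P "\<lambda>x. f x n" r m] f c by (simp add: bilinear_map_def)
  qed auto
qed

lemma tensor_class_self: "set xs \<subseteq> carrier M \<times> carrier N \<Longrightarrow> xs \<in> tensor_class K M N xs"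
  by (simp add: tensor_class_def tensor_eq.refl)

lemma tensor_class_eq: "tensor_eq K M N xs ys \<Longrightarrow> tensor_class K M N xs = tensor_class K M N ys"
  by (auto simp: tensor_class_def intro: tensor_eq.trans tensor_eq.sym)

lemma tlift_tensor_class:
  assumes P: "module K P" and f: "bilinear_map K M N P f" and xs: "set xs \<subseteq> carrier M \<times> carrier N"
  shows "tlift P f (tensor_class K M N xs) = tsum P f xs"
proof -
  have "(SOME ys. ys \<in> tensor_class K M N xs) \<in> tensor_class K M N xs"
    using tensor_class_self[OF xs] by (rule someI)
  then have "tensor_eq K M N xs (SOME ys. ys \<in> tensor_class K M N xs)" by (simp add: tensor_class_def)
  from tsum_eq[OF P f this] show ?thesis by (simp add: tlift_def tsum_def)
qed

lemma tlift_tens: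
  assumes P: "module K P" and f: "bilinear_map K M N P f" and "m \<in> carrier M" "n \<in> carrier N"
  shows "tlift P f (tens K M N m n) = f m n"
proof -
  interpret P: module K P by fact
  have c: "f m n \<in> carrier P"
    using f assms by (auto simp: bilinear_map_def linear_map_def)
  show ?thesis using tlift_tensor_class[OF P f, of "[(m,n)]"] assms c by (simp add: tens_def)
qed

lemma tensor_class_add:
  assumes "set xs \<subseteq> carrier M \<times> carrier N" "set ys \<subseteq> carrier M \<times> carrier N"
  shows "tensor_class K M N xs \<oplus>\<^bsub>tensor K M N\<^esub> tensor_class K M N ys = tensor_class K M N (xs @ ys)"
proof -
  have "tensor_class K M N (xs' @ ys') = tensor_class K M N (xs @ ys)" 
    if "xs' \<in> tensor_class K M N xs" "ys' \<in> tensor_class K M N ys" for xs' ys'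
    using that by (intro tensor_class_eq) (auto simp: tensor_class_def intro: tensor_eq.append tensor_eq.sym)
  then have "(\<Union>xs'\<in>tensor_class K M N xs. \<Union>ys'\<in>tensor_class K M N ys. tensor_class K M N (xs' @ ys')) = (\<Union>xs'\<in>tensor_class K M N xs. \<Union>ys'\<in>tensor_class K M N ys. tensor_class K M N (xs @ ys))"
    by (intro SUP_cong refl) auto
  also have "\<dots> = tensor_class K M N (xs @ ys)" using tensor_class_self[OF assms(1)] tensor_class_self[OF assms(2)] by fastforce
  finally show ?thesis by (simp add: tensor_def)
qed

lemma tensor_eq_smult:
  assumes r: "r \<in> carrier K" and "tensor_eq K M N xs ys"
  shows "tensor_eq K M N (map (\<lambda>(m, n). (r \<odot>\<^bsub>M\<^esub> m, n)) xs) (map (\<lambda>(m, n). (r \<odot>\<^bsub>M\<^esub> m, n)) ys)"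
  using assms(2)
proof induction
  case (balanced s m n)
  have "r \<odot>\<^bsub>M\<^esub> (s \<odot>\<^bsub>M\<^esub> m) = s \<odot>\<^bsub>M\<^esub> (r \<odot>\<^bsub>M\<^esub> m)"
    using balanced r by (metis M.smult_assoc1 M.R.m_comm)
  then show ?case using balanced r tensor_eq.balanced[of s K "r \<odot>\<^bsub>M\<^esub> m" M n N] by simp
next
  case (add_left m m' n)
  then show ?case using r tensor_eq.add_left[of "r \<odot>\<^bsub>M\<^esub> m" M "r \<odot>\<^bsub>M\<^esub> m'" n] by (simp add: M.smult_r_distr)
next
  case (zero_left n) then show ?case using r by (auto intro: tensor_eq.zero_left)
next
  case (refl xs) then show ?case using r by (intro tensor_eq.refl) auto
next
  case (comm xs ys) then show ?case using r unfolding map_append by (intro tensor_eq.comm) auto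
next
  case (trans xs ys zs) then show ?case by (blast intro: tensor_eq.trans)
next
  case append then show ?case by (auto intro: tensor_eq.append)
qed (use r in \<open>auto intro: tensor_eq.intros\<close>)

lemma tensor_class_smult:
  assumes "r \<in> carrier K" "set xs \<subseteq> carrier M \<times> carrier N"
  shows "r \<odot>\<^bsub>tensor K M N\<^esub> tensor_class K M N xs = tensor_class K M N (map (\<lambda>(m, n). (r \<odot>\<^bsub>M\<^esub> m, n)) xs)"
proof -
  have "tensor_class K M N (map (\<lambda>(m, n). (r \<odot>\<^bsub>M\<^esub> m, n)) ys) = tensor_class K M N (map (\<lambda>(m, n). (r \<odot>\<^bsub>M\<^esub> m, n)) xs)" 
    if "ys \<in> tensor_class K M N xs" for ys
    using that tensor_eq_smult[OF assms(1)] by (intro tensor_class_eq) (auto simp: tensor_class_def intro: tensor_eq.sym)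
  then have "(\<Union>ys\<in>tensor_class K M N xs. tensor_class K M N (map (\<lambda>(m, n). (r \<odot>\<^bsub>M\<^esub> m, n)) ys)) = (\<Union>ys\<in>tensor_class K M N xs. tensor_class K M N (map (\<lambda>(m, n). (r \<odot>\<^bsub>M\<^esub> m, n)) xs))"
    by (intro SUP_cong refl) auto
  also have "\<dots> = tensor_class K M N (map (\<lambda>(m, n). (r \<odot>\<^bsub>M\<^esub> m, n)) xs)" using tensor_class_self[OF assms(2)] by fastforce
  finally show ?thesis by (simp add: tensor_def)
qed

lemma tensor_carrier_iff: "X \<in> carrier (tensor K M N) \<longleftrightarrow> (\<exists>xs. set xs \<subseteq> carrier M \<times> carrier N \<and> X = tensor_class K M N xs)"
  by (auto simp: tensor_def lists_eq_set image_iff)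

lemma tensor_eq_smult_distr: assumes "set xs \<subseteq> carrier M \<times> carrier N" and "r \<in> carrier K" "s \<in> carrier K"
  shows "tensor_eq K M N (map (\<lambda>(m, n). ((r \<oplus>\<^bsub>K\<^esub> s) \<odot>\<^bsub>M\<^esub> m, n)) xs) (map (\<lambda>(m, n). (r \<odot>\<^bsub>M\<^esub> m, n)) xs @ map (\<lambda>(m, n). (s \<odot>\<^bsub>M\<^esub> m, n)) xs)"
  using assms(1)
proof (induction xs)
  case Nil then show ?case by (auto intro: tensor_eq.refl)
next
  case (Cons x xs)
  obtain m n where x: "x = (m,n)" by (cases x)
  let ?r = "map (\<lambda>(m, n). (r \<odot>\<^bsub>M\<^esub> m, n))" and ?s = "map (\<lambda>(m, n). (s \<odot>\<^bsub>M\<^esub> m, n))"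
  have mn: "m \<in> carrier M" "n \<in> carrier N" using Cons x by auto
  have "tensor_eq K M N [((r \<oplus>\<^bsub>K\<^esub> s) \<odot>\<^bsub>M\<^esub> m, n)] [(r \<odot>\<^bsub>M\<^esub> m, n), (s \<odot>\<^bsub>M\<^esub> m, n)]"
    using mn assms tensor_eq.add_left[of "r \<odot>\<^bsub>M\<^esub> m" M "s \<odot>\<^bsub>M\<^esub> m" n] by (simp add: M.smult_l_distr)
  from tensor_eq.append[OF this Cons.IH] Cons.prems
  have 1: "tensor_eq K M N (map (\<lambda>(m, n). ((r \<oplus>\<^bsub>K\<^esub> s) \<odot>\<^bsub>M\<^esub> m, n)) (x#xs)) ([(r \<odot>\<^bsub>M\<^esub> m, n)] @ ([(s \<odot>\<^bsub>M\<^esub> m, n)] @ ?r xs) @ ?s xs)"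
    by (simp add: x)
  have rs: "set (?r xs) \<subseteq> carrier M \<times> carrier N" "set (?s xs) \<subseteq> carrier M \<times> carrier N" using Cons.prems assms by auto
  have 2: "tensor_eq K M N ([(r \<odot>\<^bsub>M\<^esub> m, n)] @ ([(s \<odot>\<^bsub>M\<^esub> m, n)] @ ?r xs) @ ?s xs) ([(r \<odot>\<^bsub>M\<^esub> m, n)] @ (?r xs @ [(s \<odot>\<^bsub>M\<^esub> m, n)]) @ ?s xs)"
    using mn assms rs by (intro tensor_eq.append tensor_eq.comm tensor_eq.refl) auto
  show ?case using tensor_eq.trans[OF 1 2] by (simp add: x)
qed

lemma tensor_eq_smult_zero: assumes "set xs \<subseteq> carrier M \<times> carrier N"
  shows "tensor_eq K M N (map (\<lambda>(m, n). (\<zero>\<^bsub>K\<^esub> \<odot>\<^bsub>M\<^esub> m, n)) xs) []"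
  using assms
proof (induction xs)
  case Nil then show ?case by (auto intro: tensor_eq.refl)
next
  case (Cons x xs)
  obtain m n where x: "x = (m,n)" by (cases x)
  have "tensor_eq K M N [(\<zero>\<^bsub>M\<^esub>, n)] []" using Cons x by (intro tensor_eq.zero_left) auto
  from tensor_eq.append[OF this Cons.IH] Cons.prems show ?case by (simp add: x)
qed

lemma map_smult_one: "set xs \<subseteq> carrier M \<times> carrier N \<Longrightarrow> map (\<lambda>(m, n). (\<one>\<^bsub>K\<^esub> \<odot>\<^bsub>M\<^esub> m, n)) xs = xs"
  by (induction xs) auto

lemma tensor_module: "module K (tensor K M N)"
proof (rule moduleI)
  let ?T = "tensor K M N"
  let ?s = "\<lambda>r. map (\<lambda>(m, n). (r \<odot>\<^bsub>M\<^esub> m, n))"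
  have sc: "set (?s r xs) \<subseteq> carrier M \<times> carrier N" if "r \<in> carrier K" "set xs \<subseteq> carrier M \<times> carrier N" for r xs
    using that by auto
  have z: "\<zero>\<^bsub>?T\<^esub> = tensor_class K M N []" by (simp add: tensor_def)
  show "cring K" by unfold_locales
  show "abelian_group ?T"
  proof (rule abelian_groupI)
    fix x assume "x \<in> carrier ?T"
    then obtain xs where x: "set xs \<subseteq> carrier M \<times> carrier N" "x = tensor_class K M N xs" by (auto simp: tensor_carrier_iff)
    let ?m = "\<ominus>\<^bsub>K\<^esub> \<one>\<^bsub>K\<^esub>"
    have "tensor_eq K M N (?s ?m xs @ ?s \<one>\<^bsub>K\<^esub> xs) []"
      using tensor_eq.trans[OF tensor_eq.sym[OF tensor_eq_smult_distr[of xs ?m "\<one>\<^bsub>K\<^esub>"]]] tensor_eq_smult_zero[OF x(1)] x(1) by (simp add: M.R.l_neg)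
    then have "tensor_class K M N (?s ?m xs) \<oplus>\<^bsub>?T\<^esub> x = \<zero>\<^bsub>?T\<^esub>"
      using x sc[of ?m xs] by (simp add: tensor_class_add map_smult_one z tensor_class_eq)
    then show "\<exists>y\<in>carrier ?T. y \<oplus>\<^bsub>?T\<^esub> x = \<zero>\<^bsub>?T\<^esub>" using sc[of ?m xs] x by (metis tensor_carrier_iff M.R.a_inv_closed M.R.one_closed)
  next
    fix x y assume "x \<in> carrier ?T" "y \<in> carrier ?T"
    then show "x \<oplus>\<^bsub>?T\<^esub> y = y \<oplus>\<^bsub>?T\<^esub> x" unfolding tensor_carrier_iff by (elim exE conjE) (simp add: tensor_class_add tensor_class_eq[OF tensor_eq.comm])
  next
    fix x y assume "x \<in> carrier ?T" "y \<in> carrier ?T"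
    then obtain xs ys where "set xs \<subseteq> carrier M \<times> carrier N" "x = tensor_class K M N xs" "set ys \<subseteq> carrier M \<times> carrier N" "y = tensor_class K M N ys" by (auto simp: tensor_carrier_iff)
    then show "x \<oplus>\<^bsub>?T\<^esub> y \<in> carrier ?T" unfolding tensor_carrier_iff by (intro exI[of _ "xs @ ys"]) (auto simp: tensor_class_add)
  next
    show "\<zero>\<^bsub>?T\<^esub> \<in> carrier ?T" unfolding tensor_carrier_iff by (intro exI[of _ "[]"]) (auto simp: z)
  qed (auto simp: tensor_carrier_iff tensor_class_add z)
  fix a b x y assume *: "a \<in> carrier K" "x \<in> carrier ?T"
  then obtain xs where x: "set xs \<subseteq> carrier M \<times> carrier N" "x = tensor_class K M N xs" by (auto simp: tensor_carrier_iff)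
  show "a \<odot>\<^bsub>?T\<^esub> x \<in> carrier ?T" unfolding tensor_carrier_iff using * x by (intro exI[of _ "?s a xs"]) (auto simp: tensor_class_smult)
  show "a \<odot>\<^bsub>?T\<^esub> (x \<oplus>\<^bsub>?T\<^esub> y) = a \<odot>\<^bsub>?T\<^esub> x \<oplus>\<^bsub>?T\<^esub> a \<odot>\<^bsub>?T\<^esub> y" if yT: "y \<in> carrier ?T"
  proof -
    obtain ys where y: "set ys \<subseteq> carrier M \<times> carrier N" "y = tensor_class K M N ys" using yT by (auto simp: tensor_carrier_iff)
    show ?thesis using x y * sc[of a xs] sc[of a ys] by (simp add: tensor_class_add tensor_class_smult)
  qed
  assume b: "b \<in> carrier K"
  show "(a \<oplus>\<^bsub>K\<^esub> b) \<odot>\<^bsub>?T\<^esub> x = a \<odot>\<^bsub>?T\<^esub> x \<oplus>\<^bsub>?T\<^esub> b \<odot>\<^bsub>?T\<^esub> x"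
    using x * b sc[of a xs] sc[of b xs] tensor_class_eq[OF tensor_eq_smult_distr[OF x(1) *(1) b]] by (simp add: tensor_class_add tensor_class_smult)
  have e: "?s (a \<otimes>\<^bsub>K\<^esub> b) xs = ?s a (?s b xs)" using x * b by (auto simp: M.smult_assoc1)
  have ab: "a \<otimes>\<^bsub>K\<^esub> b \<in> carrier K" using * b by simp
  show "(a \<otimes>\<^bsub>K\<^esub> b) \<odot>\<^bsub>?T\<^esub> x = a \<odot>\<^bsub>?T\<^esub> (b \<odot>\<^bsub>?T\<^esub> x)"
    unfolding x(2) tensor_class_smult[OF ab x(1)] tensor_class_smult[OF b x(1)] tensor_class_smult[OF *(1) sc[OF b x(1)]] e ..
next
  fix x assume "x \<in> carrier (tensor K M N)"
  then show "\<one>\<^bsub>K\<^esub> \<odot>\<^bsub>tensor K M N\<^esub> x = x" by (auto simp: tensor_carrier_iff tensor_class_smult map_smult_one)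
qed

lemma tens_closed: "m \<in> carrier M \<Longrightarrow> n \<in> carrier N \<Longrightarrow> tens K M N m n \<in> carrier (tensor K M N)"
  unfolding tensor_carrier_iff tens_def by (intro exI[of _ "[(m,n)]"]) auto

lemma tens_bilinear: "bilinear_map K M N (tensor K M N) (tens K M N)"
  unfolding bilinear_map_def linear_map_def
  by (auto simp: tens_closed) (simp_all add: tens_def tensor_class_add tensor_class_smult tensor_class_eq[OF tensor_eq.add_left] tensor_class_eq[OF tensor_eq.add_right] tensor_class_eq[OF tensor_eq.balanced])

lemma tlift_linear:
  assumes P: "module K P" and f: "bilinear_map K M N P f"
  shows "linear_map K (tensor K M N) P (tlift P f)"
proof -
  interpret P: module K P by fact
  have c: "m \<in> carrier M \<Longrightarrow> n \<in> carrier N \<Longrightarrow> f m n \<in> carrier P" for m n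
    using f by (auto simp: bilinear_map_def linear_map_def)
  have s: "f (r \<odot>\<^bsub>M\<^esub> m) n = r \<odot>\<^bsub>P\<^esub> f m n" if "r \<in> carrier K" "m \<in> carrier M" "n \<in> carrier N" for r m n
    using f that by (auto simp: bilinear_map_def linear_map_def)
  have sm: "tsum P f (map (\<lambda>(m, n). (r \<odot>\<^bsub>M\<^esub> m, n)) xs) = r \<odot>\<^bsub>P\<^esub> tsum P f xs" if "r \<in> carrier K" "set xs \<subseteq> carrier M \<times> carrier N" for r xs
    using that(2)
  proof (induction xs)
    case (Cons x xs) then show ?case using that c s tsum_closed[OF P f, of xs] by (auto simp: P.smult_r_distr)
  qed (use that in simp)
  have sc: "set (map (\<lambda>(m, n). (r \<odot>\<^bsub>M\<^esub> m, n)) xs) \<subseteq> carrier M \<times> carrier N" if "r \<in> carrier K" "set xs \<subseteq> carrier M \<times> carrier N" for r xs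
    using that by auto
  show ?thesis unfolding linear_map_def
    using tsum_closed[OF P f] tsum_append[OF P f]
    by (auto simp: tensor_carrier_iff tensor_class_add tensor_class_smult tlift_tensor_class[OF P f] sm sc simp del: set_map)
qed

end


subsection \<open>The tensor product of algebras\<close>

definition tensor_algebra ::
    "('k, 'c) ring_scheme \<Rightarrow> ('k, 'a, 'x) module_scheme \<Rightarrow> ('k, 'b, 'y) module_scheme
      \<Rightarrow> ('k, ('a \<times> 'b) list set) module" where
  "tensor_algebra K A B = (tensor K A B)
    \<lparr> mult := (\<lambda>X Y. tlift (tensor K A B) (\<lambda>a u. tlift (tensor K A B)
         (\<lambda>b v. tens K A B (a \<otimes>\<^bsub>A\<^esub> b) (u \<otimes>\<^bsub>B\<^esub> v)) Y) X),
      one := tens K A B \<one>\<^bsub>A\<^esub> \<one>\<^bsub>B\<^esub> \<rparr>"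


section \<open>Hopf algebras\<close>

record ('k, 'h) hopf = "('k, 'h) module" +
  comult :: "'h \<Rightarrow> ('h \<times> 'h) list set"
  counit :: "'h \<Rightarrow> 'k"
  antipode :: "'h \<Rightarrow> 'h"

text \<open>\<open>sweedler2 P H f h\<close> is \<open>f h\<^sup>(\<^sup>0\<^sup>) h\<^sup>(\<^sup>1\<^sup>)\<close> and \<open>sweedler3 P H f h\<close> is
  \<open>f h\<^sup>(\<^sup>0\<^sup>) h\<^sup>(\<^sup>1\<^sup>) h\<^sup>(\<^sup>2\<^sup>)\<close>, with values in \<open>P\<close>.\<close>

definition sweedler2 ::
    "('k, 'p, 'z) module_scheme \<Rightarrow> ('k, 'h, 'y) hopf_scheme
      \<Rightarrow> ('h \<Rightarrow> 'h \<Rightarrow> 'p) \<Rightarrow> 'h \<Rightarrow> 'p" where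
  "sweedler2 P H f h = tlift P f (comult H h)"

definition sweedler3 ::
    "('k, 'p, 'z) module_scheme \<Rightarrow> ('k, 'h, 'y) hopf_scheme
      \<Rightarrow> ('h \<Rightarrow> 'h \<Rightarrow> 'h \<Rightarrow> 'p) \<Rightarrow> 'h \<Rightarrow> 'p" where
  "sweedler3 P H f h = sweedler2 P H (\<lambda>g z. sweedler2 P H (\<lambda>x y. f x y z) g) h"

locale hopf_algebra = field K + unital_algebra K H for K (structure) and H (structure) +
  assumes comult_linear: "linear_map K H (tensor K H H) (comult H)"
    and comult_hom: "comult H \<in> ring_hom H (tensor_algebra K H H)"
    and coassoc: "h \<in> carrier H \<Longrightarrow>
      sweedler3 (tensor K H (tensor K H H)) H
        (\<lambda>x y z. tens K H (tensor K H H) x (tens K H H y z)) h =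
      sweedler2 (tensor K H (tensor K H H)) H
        (\<lambda>x y. tens K H (tensor K H H) x (comult H y)) h"
    and counit_smult: "r \<in> carrier K \<Longrightarrow> h \<in> carrier H
      \<Longrightarrow> counit H (r \<odot>\<^bsub>H\<^esub> h) = r \<otimes>\<^bsub>K\<^esub> counit H h"
    and counit_hom: "counit H \<in> ring_hom H K"
    and counit_left: "h \<in> carrier H \<Longrightarrow> sweedler2 H H (\<lambda>x y. counit H x \<odot>\<^bsub>H\<^esub> y) h = h"
    and counit_right: "h \<in> carrier H \<Longrightarrow> sweedler2 H H (\<lambda>x y. counit H y \<odot>\<^bsub>H\<^esub> x) h = h"
    and antipode_linear: "linear_map K H H (antipode H)"
    and antipode_left: "h \<in> carrier H \<Longrightarrow>
      sweedler2 H H (\<lambda>x y. antipode H x \<otimes>\<^bsub>H\<^esub> y) h = counit H h \<odot>\<^bsub>H\<^esub> \<one>\<^bsub>H\<^esub>"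
    and antipode_right: "h \<in> carrier H \<Longrightarrow>
      sweedler2 H H (\<lambda>x y. x \<otimes>\<^bsub>H\<^esub> antipode H y) h = counit H h \<odot>\<^bsub>H\<^esub> \<one>\<^bsub>H\<^esub>"


section \<open>Modules and algebras over a Hopf algebra\<close>

locale representation = module K V
  for K (structure) and H :: "('k, 'h, 'z) hopf_scheme" (structure) and V (structure)
    and act :: "'h \<Rightarrow> 'v \<Rightarrow> 'v" +
  assumes act_bilinear: "bilinear_map K H V V act"
    and act_mult: "g \<in> carrier H \<Longrightarrow> h \<in> carrier H \<Longrightarrow> v \<in> carrier V
      \<Longrightarrow> act (g \<otimes>\<^bsub>H\<^esub> h) v = act g (act h v)"
    and act_one: "v \<in> carrier V \<Longrightarrow> act \<one>\<^bsub>H\<^esub> v = v"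

locale H_algebra = representation K H A act + unital_algebra K A
  for K (structure) and H :: "('k, 'h, 'z) hopf_scheme" (structure) and A (structure)
    and act :: "'h \<Rightarrow> 'a \<Rightarrow> 'a" +
  assumes act_prod: "h \<in> carrier H \<Longrightarrow> a \<in> carrier A \<Longrightarrow> b \<in> carrier A
      \<Longrightarrow> act h (a \<otimes>\<^bsub>A\<^esub> b) = sweedler2 A H (\<lambda>x y. act x a \<otimes>\<^bsub>A\<^esub> act y b) h"
    and act_unit: "h \<in> carrier H \<Longrightarrow> act h \<one>\<^bsub>A\<^esub> = counit H h \<odot>\<^bsub>A\<^esub> \<one>\<^bsub>A\<^esub>"

definition H_algebra_iso ::
    "('k, 'c) ring_scheme \<Rightarrow> ('k, 'h, 'z) hopf_scheme
      \<Rightarrow> ('k, 'a, 'x) module_scheme \<Rightarrow> ('h \<Rightarrow> 'a \<Rightarrow> 'a)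
      \<Rightarrow> ('k, 'b, 'y) module_scheme \<Rightarrow> ('h \<Rightarrow> 'b \<Rightarrow> 'b) \<Rightarrow> ('a \<Rightarrow> 'b) set" where
  "H_algebra_iso K H A actA B actB =
    {f \<in> algebra_iso K A B.
       \<forall>h\<in>carrier H. \<forall>a\<in>carrier A. f (actA h a) = actB h (f a)}"

locale yetter_drinfeld_algebra = H_algebra K H A act
  for K (structure) and H :: "('k, 'h, 'z) hopf_scheme" (structure) and A (structure)
    and act :: "'h \<Rightarrow> 'a \<Rightarrow> 'a" and \<rho> :: "'a \<Rightarrow> ('a \<times> 'h) list set" +
  assumes coact_linear: "linear_map K A (tensor K A H) \<rho>"
    and coact_coassoc: "a \<in> carrier A \<Longrightarrow>
      tlift (tensor K A (tensor K H H)) (\<lambda>b z. tlift (tensor K A (tensor K H H))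
        (\<lambda>x y. tens K A (tensor K H H) x (tens K H H y z)) (\<rho> b)) (\<rho> a) =
      tlift (tensor K A (tensor K H H)) (\<lambda>x y. tens K A (tensor K H H) x (comult H y)) (\<rho> a)"
    and coact_counit: "a \<in> carrier A \<Longrightarrow> tlift A (\<lambda>x y. counit H y \<odot>\<^bsub>A\<^esub> x) (\<rho> a) = a"
    and coact_mult: "a \<in> carrier A \<Longrightarrow> b \<in> carrier A \<Longrightarrow>
      \<rho> (a \<otimes>\<^bsub>A\<^esub> b) =
      tlift (tensor K A H) (\<lambda>a0 a1. tlift (tensor K A H)
        (\<lambda>b0 b1. tens K A H (a0 \<otimes>\<^bsub>A\<^esub> b0) (b1 \<otimes>\<^bsub>H\<^esub> a1)) (\<rho> b)) (\<rho> a)"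
    and coact_one: "\<rho> \<one>\<^bsub>A\<^esub> = tens K A H \<one>\<^bsub>A\<^esub> \<one>\<^bsub>H\<^esub>"
    and yetter_drinfeld: "h \<in> carrier H \<Longrightarrow> a \<in> carrier A \<Longrightarrow>
      sweedler2 (tensor K A H) H (\<lambda>h0 h1. tlift (tensor K A H)
        (\<lambda>b0 b1. tens K A H b0 (b1 \<otimes>\<^bsub>H\<^esub> h0)) (\<rho> (act h1 a))) h =
      sweedler2 (tensor K A H) H (\<lambda>h0 h1. tlift (tensor K A H)
        (\<lambda>a0 a1. tens K A H (act h0 a0) (h1 \<otimes>\<^bsub>H\<^esub> a1)) (\<rho> a)) h"


section \<open>The algebra of endomorphisms\<close>

text \<open>Endomorphisms are \<^const>\<open>extensional\<close>, so that they are determined by their values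
  on the carrier.\<close>

definition End_algebra ::
    "('k, 'c) ring_scheme \<Rightarrow> ('k, 'v, 'x) module_scheme \<Rightarrow> ('k, 'v \<Rightarrow> 'v) module" where
  "End_algebra K V =
    \<lparr> carrier = {u \<in> extensional (carrier V). linear_map K V V u},
      mult = compose (carrier V),
      one = (\<lambda>x\<in>carrier V. x),
      zero = (\<lambda>x\<in>carrier V. \<zero>\<^bsub>V\<^esub>),
      add = (\<lambda>u v. \<lambda>x\<in>carrier V. u x \<oplus>\<^bsub>V\<^esub> v x),
      smult = (\<lambda>r u. \<lambda>x\<in>carrier V. r \<odot>\<^bsub>V\<^esub> u x) \<rparr>"

lemma End_unital_algebra:
  assumes V: "module K V" shows "unital_algebra K (End_algebra K V)"
proof -
  interpret V: module K V by fact
  have ring: "ring (End_algebra K V)"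
  proof (rule ringI)
    show "abelian_group (End_algebra K V)"
    proof (rule abelian_groupI)
      fix x assume x: "x \<in> carrier (End_algebra K V)"
      let ?y = "\<lambda>v\<in>carrier V. \<ominus>\<^bsub>V\<^esub> x v"
      show "\<exists>y\<in>carrier (End_algebra K V). y \<oplus>\<^bsub>End_algebra K V\<^esub> x = \<zero>\<^bsub>End_algebra K V\<^esub>"
        using x by (intro bexI[of _ ?y]) (auto simp: End_algebra_def linear_map_def V.M.l_neg V.smult_r_minus V.M.minus_add Pi_iff intro!: ext)
    qed (auto simp: End_algebra_def linear_map_def Pi_iff V.smult_r_distr V.M.a_ac fun_eq_iff extensional_def)
    show "monoid (End_algebra K V)"
      by (rule monoidI) (auto simp: End_algebra_def linear_map_def Pi_iff compose_def fun_eq_iff extensional_def)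
  qed (auto simp: End_algebra_def linear_map_def Pi_iff compose_def fun_eq_iff)
  have mod: "module K (End_algebra K V)"
    apply (rule moduleI)
    using ring[THEN ring.is_abelian_group] V.R.is_cring apply -
          apply (auto simp: End_algebra_def linear_map_def Pi_iff fun_eq_iff extensional_def V.smult_r_distr V.smult_l_distr V.smult_assoc1[symmetric] V.R.m_comm)
    done
  show ?thesis
    using mod ring by (auto simp: unital_algebra_def unital_algebra_axioms_def bilinear_map_def)
     (auto simp: End_algebra_def linear_map_def Pi_iff compose_def fun_eq_iff V.smult_r_distr)
qed

definition oper ::
    "('k, 'v, 'x) module_scheme \<Rightarrow> ('h \<Rightarrow> 'v \<Rightarrow> 'v) \<Rightarrow> 'h \<Rightarrow> 'v \<Rightarrow> 'v" where
  "oper V act h = (\<lambda>x\<in>carrier V. act h x)"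

definition End_act ::
    "('k, 'c) ring_scheme \<Rightarrow> ('k, 'h, 'z) hopf_scheme \<Rightarrow> ('k, 'v, 'x) module_scheme
      \<Rightarrow> ('h \<Rightarrow> 'v \<Rightarrow> 'v) \<Rightarrow> 'h \<Rightarrow> ('v \<Rightarrow> 'v) \<Rightarrow> 'v \<Rightarrow> 'v" where
  "End_act K H V act h u =
    sweedler2 (End_algebra K V) H
      (\<lambda>x y. oper V act x \<otimes>\<^bsub>End_algebra K V\<^esub> u \<otimes>\<^bsub>End_algebra K V\<^esub> oper V act (antipode H y)) h"


section \<open>The two structures on the tensor product with the endomorphism algebra\<close>

text \<open>For the structure with the componentwise product, the algebra is \<open>tensor_algebra K A (End_algebra K V)\<close>.\<close>

definition bar_act ::
    "('k, 'c) ring_scheme \<Rightarrow> ('k, 'h, 'z) hopf_scheme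
      \<Rightarrow> ('k, 'a, 'x) module_scheme \<Rightarrow> ('h \<Rightarrow> 'a \<Rightarrow> 'a)
      \<Rightarrow> ('k, 'v, 'y) module_scheme \<Rightarrow> ('h \<Rightarrow> 'v \<Rightarrow> 'v)
      \<Rightarrow> 'h \<Rightarrow> ('a \<times> ('v \<Rightarrow> 'v)) list set \<Rightarrow> ('a \<times> ('v \<Rightarrow> 'v)) list set" where
  "bar_act K H A actA V actV h X =
    (let E = End_algebra K V; T = tensor K A E in
      tlift T (\<lambda>a u. sweedler3 T H
        (\<lambda>x y z. tens K A E (actA y a)
           (oper V actV x \<otimes>\<^bsub>E\<^esub> u \<otimes>\<^bsub>E\<^esub> oper V actV (antipode H z))) h) X)"

definition braided_algebra ::
    "('k, 'c) ring_scheme \<Rightarrow> ('k, 'h, 'z) hopf_scheme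
      \<Rightarrow> ('k, 'a, 'x) module_scheme \<Rightarrow> ('a \<Rightarrow> ('a \<times> 'h) list set)
      \<Rightarrow> ('k, 'v, 'y) module_scheme \<Rightarrow> ('h \<Rightarrow> 'v \<Rightarrow> 'v)
      \<Rightarrow> ('k, ('a \<times> ('v \<Rightarrow> 'v)) list set) module" where
  "braided_algebra K H A \<rho> V actV =
    (let E = End_algebra K V; T = tensor K A E in
      T \<lparr> mult := (\<lambda>X Y. tlift T (\<lambda>a u. tlift T (\<lambda>c v. tlift T
            (\<lambda>c0 c1. tens K A E (a \<otimes>\<^bsub>A\<^esub> c0) (End_act K H V actV c1 u \<otimes>\<^bsub>E\<^esub> v)) (\<rho> c)) Y) X),
          one := tens K A E \<one>\<^bsub>A\<^esub> \<one>\<^bsub>E\<^esub> \<rparr>)"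

definition diag_act ::
    "('k, 'c) ring_scheme \<Rightarrow> ('k, 'h, 'z) hopf_scheme
      \<Rightarrow> ('k, 'a, 'x) module_scheme \<Rightarrow> ('h \<Rightarrow> 'a \<Rightarrow> 'a)
      \<Rightarrow> ('k, 'v, 'y) module_scheme \<Rightarrow> ('h \<Rightarrow> 'v \<Rightarrow> 'v)
      \<Rightarrow> 'h \<Rightarrow> ('a \<times> ('v \<Rightarrow> 'v)) list set \<Rightarrow> ('a \<times> ('v \<Rightarrow> 'v)) list set" where
  "diag_act K H A actA V actV h X =
    (let E = End_algebra K V; T = tensor K A E in
      tlift T (\<lambda>a u. sweedler2 T H
        (\<lambda>x y. tens K A E (actA x a) (End_act K H V actV y u)) h) X)"

end

theory Submission
  imports Defs
begin

text \<open>
  Only the algebra homomorphism from \<open>H\<close> to \<open>E = End(V)\<close>, written \<open>p\<close>, matters.  The isomorphism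
  from the bar structure to the braided one is \<open>\<Phi> (a \<otimes> u) = a\<^sub>0 \<otimes> p(a\<^sub>1) u\<close>, with inverse
  \<open>a \<otimes> u \<mapsto> a\<^sub>0 \<otimes> p(S a\<^sub>1) u\<close>.  It is multiplicative because
  \<open>(c\<^sub>1 \<cdot> p(a\<^sub>1) u) p(c\<^sub>2) v = p(c\<^sub>1) p(a\<^sub>1) u p(S c\<^sub>2) p(c\<^sub>3) v = p(c\<^sub>1 a\<^sub>1) u v\<close>, and the
  Yetter-Drinfeld condition makes it equivariant.  The bar structure is an \<open>H\<close>-algebra by direct
  computation, using that \<open>S\<close> is anti-multiplicative; transport along \<open>\<Phi>\<close> then shows the same for
  the braided structure, so that the associativity of the braided product need not be checked.
\<close>

section \<open>Sums over the components of a tensor\<close>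

text \<open>In the braided structure \<open>(1 \<otimes> u)(c \<otimes> 1) = c\<^sub>0 \<otimes>
  c\<^sub>1 \<cdot> u\<close>, so the copies of \<open>A\<close> and \<open>E\<close> need not
  commute, as they do in the bar structure. The action on \<open>E\<close> is inner, however:
  \<open>(h\<^sub>0 \<cdot> u) p(h\<^sub>1) = p(h) u\<close>. Hence every
  \<open>c\<^sub>0 \<otimes> p(c\<^sub>1)\<close> commutes with every \<open>1 \<otimes> u\<close>,
  and since the coaction reverses products in \<open>H\<close>, these elements multiply as the
  \<open>c\<close> do. The map \<Phi> sends \<open>c \<otimes> u\<close> to
  \<open>(c\<^sub>0 \<otimes> p(c\<^sub>1))(1 \<otimes> u)\<close>. The formal obstacle is that the
  axioms are identities between single tensors, whereas the calculations nest several Sweedler sums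
  in one expression. Each axiom is therefore turned into a rule for arbitrary multilinear summands,
  by evaluating both sides with the linear map that the summand induces.\<close>

text \<open>Agrees with \<^const>\<open>tlift\<close> on tensors; discarding the values of \<open>f\<close> outside the carriers
  makes the congruence rule below unconditional, so that the simplifier can work under the sum.\<close>

definition tensor_sum ::
    "('k, 'm, 'x) module_scheme \<Rightarrow> ('k, 'n, 'y) module_scheme \<Rightarrow> ('k, 'p, 'z) module_scheme
      \<Rightarrow> ('m \<Rightarrow> 'n \<Rightarrow> 'p) \<Rightarrow> ('m \<times> 'n) list set \<Rightarrow> 'p" where
  "tensor_sum M N P f X =
    tlift P (\<lambda>m n. if m \<in> carrier M \<and> n \<in> carrier N then f m n else undefined) X"

lemma tensor_sum_cong [cong]:
  assumes "X = Y" "\<And>m n. m \<in> carrier M \<Longrightarrow> n \<in> carrier N \<Longrightarrow> f m n = g m n"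
  shows "tensor_sum M N P f X = tensor_sum M N P g Y"
proof -
  have "(\<lambda>m n. if m \<in> carrier M \<and> n \<in> carrier N then f m n else undefined) =
        (\<lambda>m n. if m \<in> carrier M \<and> n \<in> carrier N then g m n else undefined)"
    using assms(2) by (intro ext) auto
  then show ?thesis using assms(1) by (simp add: tensor_sum_def)
qed

lemma linear_mapI:
  assumes "\<And>x. x \<in> carrier M \<Longrightarrow> f x \<in> carrier N"
    and "\<And>x y. x \<in> carrier M \<Longrightarrow> y \<in> carrier M \<Longrightarrow> f (x \<oplus>\<^bsub>M\<^esub> y) = f x \<oplus>\<^bsub>N\<^esub> f y"
    and "\<And>r x. r \<in> carrier K \<Longrightarrow> x \<in> carrier M \<Longrightarrow> f (r \<odot>\<^bsub>M\<^esub> x) = r \<odot>\<^bsub>N\<^esub> f x"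
  shows "linear_map K M N f"
  using assms by (auto simp: linear_map_def)

lemma linear_map_cong:
  assumes "module K M" "\<And>x. x \<in> carrier M \<Longrightarrow> f x = g x"
  shows "linear_map K M N f \<longleftrightarrow> linear_map K M N g"
proof -
  interpret module K M by fact
  show ?thesis using assms(2) by (auto simp: linear_map_def Pi_iff)
qed

text \<open>Used as conditional rewrite rules: closure in the carriers, and linearity of maps built from
  the structure maps.  A variable that occurs linearly occurs once, so at most one rule matches.\<close>

named_theorems linear

section \<open>Linearity of composite maps\<close>

context cring
begin

lemma linear_id [linear]: "linear_map R M M (\<lambda>x. x)"
  by (simp add: linear_map_def)

lemma linear_comp:
  "linear_map R M N f \<Longrightarrow> linear_map R Q M g \<Longrightarrow> linear_map R Q N (\<lambda>x. f (g x))"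
  by (auto simp: linear_map_def Pi_iff)

lemma linear_bilinear_left:
  "bilinear_map R M N P f \<Longrightarrow> linear_map R Q M g \<Longrightarrow> y \<in> carrier N
    \<Longrightarrow> linear_map R Q P (\<lambda>x. f (g x) y)"
  by (rule linear_comp[where f = "\<lambda>x. f x y"]) (auto simp: bilinear_map_def)

lemma linear_bilinear_right:
  "bilinear_map R M N P f \<Longrightarrow> linear_map R Q N g \<Longrightarrow> y \<in> carrier M
    \<Longrightarrow> linear_map R Q P (\<lambda>x. f y (g x))"
  by (rule linear_comp[where f = "f y"]) (auto simp: bilinear_map_def)

lemma linear_smult [linear]:
  assumes "module R P" "linear_map R Q P g" "c \<in> carrier R"
  shows "linear_map R Q P (\<lambda>x. c \<odot>\<^bsub>P\<^esub> g x)"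
proof -
  interpret P: module R P by fact
  have "c \<odot>\<^bsub>P\<^esub> (r \<odot>\<^bsub>P\<^esub> y) = r \<odot>\<^bsub>P\<^esub> (c \<odot>\<^bsub>P\<^esub> y)" if "r \<in> carrier R" "y \<in> carrier P" for r y
    using that assms(3) by (metis P.smult_assoc1 m_comm)
  then show ?thesis
    using assms by (auto simp: linear_map_def Pi_iff P.smult_r_distr)
qed

section \<open>Evaluating tensors in a module\<close>

context
  fixes M :: "('a, 'm, 'x) module_scheme" and N :: "('a, 'n, 'y) module_scheme"
  assumes M: "module R M" and N: "module R N"
begin

text \<open>All lists in a class are related to each other, and the relation holds only between
  lists with entries in the carriers; so the representative chosen by \<open>tlift\<close> is well
  formed.\<close>

lemma tensor_some_carrier:
  assumes "X \<in> carrier (tensor R M N)"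
  shows "set (SOME xs. xs \<in> X) \<subseteq> carrier M \<times> carrier N"
proof -
  obtain ys where ys: "set ys \<subseteq> carrier M \<times> carrier N" "X = tensor_class R M N ys"
    using assms tensor_carrier_iff[OF M N] by auto
  have "(SOME xs. xs \<in> X) \<in> X"
    using tensor_class_self[OF M N ys(1)] ys(2) by (auto intro: someI)
  then have "tensor_eq R M N ys (SOME xs. xs \<in> X)" using ys(2) by (simp add: tensor_class_def)
  then show ?thesis using tensor_eq_carrier[OF M N] by blast
qed

text \<open>The list depends on \<open>X\<close> alone and not on the summand. Identities between
  sums over the same tensor thus reduce to induction over one list, whether or not \<open>f\<close>
  is bilinear.\<close>

lemma tensor_sum_eq_tsum:
  assumes "X \<in> carrier (tensor R M N)"
  shows "tensor_sum M N P f X = tsum P f (SOME xs. xs \<in> X)"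
proof -
  have "tsum P (\<lambda>m n. if m \<in> carrier M \<and> n \<in> carrier N then f m n else undefined) xs = tsum P f xs"
    if "set xs \<subseteq> carrier M \<times> carrier N" for xs
    using that by (induction xs) auto
  from this[OF tensor_some_carrier[OF assms]] show ?thesis
    by (simp add: tensor_sum_def tlift_def tsum_def)
qed

lemma tensor_sum_eq_tlift:
  assumes "X \<in> carrier (tensor R M N)"
  shows "tensor_sum M N P f X = tlift P f X"
  using tensor_sum_eq_tsum[OF assms] by (simp add: tlift_def tsum_def)

text \<open>The bridge from the definitions, which are written with \<open>tlift\<close>. Applied
  repeatedly, it descends through nested lifts, because its second premise is again an equation of
  this shape.\<close>

lemma tlift_eq_tensor_sum:
  assumes "X \<in> carrier (tensor R M N)"
    and "\<And>m n. m \<in> carrier M \<Longrightarrow> n \<in> carrier N \<Longrightarrow> f m n = g m n"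
  shows "tlift P f X = tensor_sum M N P g X"
proof -
  have "tlift P f X = tensor_sum M N P f X" using tensor_sum_eq_tlift[OF assms(1)] by metis
  then show ?thesis using assms(2) by simp
qed

lemma tsum_closed':
  assumes "module R P" "set xs \<subseteq> carrier M \<times> carrier N"
    "\<And>m n. m \<in> carrier M \<Longrightarrow> n \<in> carrier N \<Longrightarrow> f m n \<in> carrier P"
  shows "tsum P f xs \<in> carrier P"
proof -
  interpret P: module R P by fact
  show ?thesis using assms(2,3) by (induction xs) auto
qed

lemma tensor_sum_closed [linear]:
  assumes "module R P" "X \<in> carrier (tensor R M N)"
    "\<And>m n. m \<in> carrier M \<Longrightarrow> n \<in> carrier N \<Longrightarrow> f m n \<in> carrier P"
  shows "tensor_sum M N P f X \<in> carrier P"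
  unfolding tensor_sum_eq_tsum[OF assms(2)]
  by (rule tsum_closed'[OF assms(1) tensor_some_carrier[OF assms(2)]]) (rule assms(3))

lemma tensor_sum_linear:
  assumes "module R P" "module R Q" "linear_map R P Q g" "X \<in> carrier (tensor R M N)"
    and f: "\<And>m n. m \<in> carrier M \<Longrightarrow> n \<in> carrier N \<Longrightarrow> f m n \<in> carrier P"
  shows "g (tensor_sum M N P f X) = tensor_sum M N Q (\<lambda>m n. g (f m n)) X"
proof -
  have "g (tsum P f xs) = tsum Q (\<lambda>m n. g (f m n)) xs" if "set xs \<subseteq> carrier M \<times> carrier N" for xs
    using that
  proof (induction xs)
    case Nil
    then show ?case using linear_map_zero[OF assms(1-3)] by simp
  next
    case (Cons x xs)
    then show ?case using linear_mapD(2)[OF assms(3)] f tsum_closed'[OF assms(1) _ f] by auto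
  qed
  then show ?thesis
    by (simp add: tensor_sum_eq_tsum[OF assms(4)] tensor_some_carrier[OF assms(4)])
qed

text \<open>Here the parameter enters through the summand while the tensor is fixed; in
  \<open>linear_tensor_sum_arg\<close> it enters through the tensor. The two cases together cover
  nested Sweedler sums.\<close>

lemma linear_tensor_sum_fun [linear]:
  assumes P: "module R P" and X: "X \<in> carrier (tensor R M N)"
    and f: "\<And>m n. m \<in> carrier M \<Longrightarrow> n \<in> carrier N \<Longrightarrow> linear_map R Q P (\<lambda>c. f c m n)"
  shows "linear_map R Q P (\<lambda>c. tensor_sum M N P (\<lambda>m n. f c m n) X)"
proof -
  interpret P: module R P by fact
  have c: "tsum P (f c) xs \<in> carrier P" if "set xs \<subseteq> carrier M \<times> carrier N" "c \<in> carrier Q" for xs c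
    using that linear_mapD(1)[OF f] by (intro tsum_closed'[OF P]) auto
  have "linear_map R Q P (\<lambda>c. tsum P (f c) xs)" if "set xs \<subseteq> carrier M \<times> carrier N" for xs
    using that
  proof (induction xs)
    case Nil
    then show ?case by (auto simp: linear_map_def)
  next
    case (Cons x xs)
    then have 1: "fst x \<in> carrier M" "snd x \<in> carrier N" "set xs \<subseteq> carrier M \<times> carrier N" by auto
    note IH = Cons.IH[OF 1(3)]
    note c = c[OF 1(3)] linear_mapD(1)[OF f[OF 1(1,2)]]
    show ?case
      using c
      by (intro linear_mapI)
        (simp_all add: linear_mapD(2,3)[OF IH] linear_mapD(2,3)[OF f[OF 1(1,2)]] P.smult_r_distr P.a_ac)
  qed
  then show ?thesis by (simp add: tensor_sum_eq_tsum[OF X] tensor_some_carrier[OF X])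
qed

lemma tensor_sum_linear_arg:
  assumes P: "module R P"
    and f: "\<And>m. m \<in> carrier M \<Longrightarrow> linear_map R N P (\<lambda>n. f m n)"
           "\<And>n. n \<in> carrier N \<Longrightarrow> linear_map R M P (\<lambda>m. f m n)"
  shows "linear_map R (tensor R M N) P (\<lambda>X. tensor_sum M N P f X)"
proof -
  have "linear_map R (tensor R M N) P (tlift P f)"
    using f by (intro tlift_linear[OF M N P]) (auto simp: bilinear_map_def)
  then show ?thesis
    by (subst linear_map_cong[OF tensor_module[OF M N], where g = "tlift P f"])
      (simp_all add: tensor_sum_eq_tlift)
qed

lemma linear_tensor_sum_arg [linear]:
  assumes "module R P"
    and "\<And>m. m \<in> carrier M \<Longrightarrow> linear_map R N P (\<lambda>n. f m n)"
        "\<And>n. n \<in> carrier N \<Longrightarrow> linear_map R M P (\<lambda>m. f m n)"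
    and "linear_map R Q (tensor R M N) g"
  shows "linear_map R Q P (\<lambda>c. tensor_sum M N P f (g c))"
  by (rule linear_comp[OF tensor_sum_linear_arg assms(4)]) (use assms in auto)

lemma tensor_sum_tens:
  assumes P: "module R P"
    and f: "\<And>m. m \<in> carrier M \<Longrightarrow> linear_map R N P (\<lambda>n. f m n)"
           "\<And>n. n \<in> carrier N \<Longrightarrow> linear_map R M P (\<lambda>m. f m n)"
    and mn: "m \<in> carrier M" "n \<in> carrier N"
  shows "tensor_sum M N P f (tens R M N m n) = f m n"
proof -
  have "bilinear_map R M N P f" using f by (auto simp: bilinear_map_def)
  from tlift_tens[OF M N P this mn] show ?thesis
    using mn by (simp add: tensor_sum_eq_tlift tens_closed[OF M N])
qed

text \<open>Every class is a finite sum of pure tensors, by induction over a representing list. This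
  reduces the identities on \<open>A \<otimes> E\<close> below to pure tensors.\<close>

lemma tensor_linear_eqI:
  assumes P: "module R P" and "linear_map R (tensor R M N) P f" "linear_map R (tensor R M N) P g"
    and eq: "\<And>m n. m \<in> carrier M \<Longrightarrow> n \<in> carrier N \<Longrightarrow> f (tens R M N m n) = g (tens R M N m n)"
    and X: "X \<in> carrier (tensor R M N)"
  shows "f X = g X"
proof -
  have T: "module R (tensor R M N)" by (rule tensor_module[OF M N])
  have f: "f (tensor_class R M N xs) = g (tensor_class R M N xs)"
    if "set xs \<subseteq> carrier M \<times> carrier N" for xs
    using that
  proof (induction xs)
    case Nil
    have "tensor_class R M N [] = \<zero>\<^bsub>tensor R M N\<^esub>" by (simp add: tensor_def)
    then show ?case using linear_map_zero[OF T P] assms(2,3) by metis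
  next
    case (Cons x xs)
    obtain m n where x: "x = (m, n)" "m \<in> carrier M" "n \<in> carrier N" using Cons.prems by auto
    have c: "tensor_class R M N xs \<in> carrier (tensor R M N)" "tens R M N m n \<in> carrier (tensor R M N)"
      using Cons.prems x tens_closed[OF M N] by (auto simp: tensor_carrier_iff[OF M N])
    have "tensor_class R M N (x # xs) = tens R M N m n \<oplus>\<^bsub>tensor R M N\<^esub> tensor_class R M N xs"
      using Cons.prems x tensor_class_add[OF M N, of "[(m, n)]" xs] by (simp add: tens_def)
    then show ?case
      using Cons eq[OF x(2,3)] c by (simp add: linear_mapD(2)[OF assms(2)] linear_mapD(2)[OF assms(3)])
  qed
  then show ?thesis using X by (auto simp: tensor_carrier_iff[OF M N])
qed

end

lemmas tens_closed' [linear] = tens_closed[where K = R]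
lemmas tensor_module' [linear] = tensor_module[where K = R]

lemma linear_tens_left [linear]:
  "module R M \<Longrightarrow> module R N \<Longrightarrow> linear_map R Q M g \<Longrightarrow> y \<in> carrier N
    \<Longrightarrow> linear_map R Q (tensor R M N) (\<lambda>x. tens R M N (g x) y)"
  by (rule linear_bilinear_left[OF tens_bilinear])

lemma linear_tens_right [linear]:
  "module R M \<Longrightarrow> module R N \<Longrightarrow> linear_map R Q N g \<Longrightarrow> y \<in> carrier M
    \<Longrightarrow> linear_map R Q (tensor R M N) (\<lambda>x. tens R M N y (g x))"
  by (rule linear_bilinear_right[OF tens_bilinear])

text \<open>Interchange of two finite sums: neither tensor depends on the components of the
  other.\<close>

lemma tensor_sum_swap:
  assumes mods: "module R M" "module R N" "module R M'" "module R N'" "module R P"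
    and X: "X \<in> carrier (tensor R M N)" and Y: "Y \<in> carrier (tensor R M' N')"
    and f: "\<And>m n m' n'. m \<in> carrier M \<Longrightarrow> n \<in> carrier N \<Longrightarrow> m' \<in> carrier M' \<Longrightarrow> n' \<in> carrier N'
      \<Longrightarrow> f m n m' n' \<in> carrier P"
  shows "tensor_sum M N P (\<lambda>m n. tensor_sum M' N' P (\<lambda>m' n'. f m n m' n') Y) X =
    tensor_sum M' N' P (\<lambda>m' n'. tensor_sum M N P (\<lambda>m n. f m n m' n') X) Y"
proof -
  interpret P: module R P by fact
  \<comment> \<open>One list per tensor, valid for all summands, so that both iterated sums run over
    the same two lists.\<close>
  obtain ys where ys: "set ys \<subseteq> carrier M' \<times> carrier N'"
    "\<And>f. tensor_sum M' N' P f Y = tsum P f ys"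
    using that[OF tensor_some_carrier[OF mods(3,4) Y] tensor_sum_eq_tsum[OF mods(3,4) Y]] .
  obtain xs where xs: "set xs \<subseteq> carrier M \<times> carrier N"
    "\<And>f. tensor_sum M N P f X = tsum P f xs"
    using that[OF tensor_some_carrier[OF mods(1,2) X] tensor_sum_eq_tsum[OF mods(1,2) X]] .
  have "tsum P (\<lambda>m n. tsum P (f m n) ys) xs = tsum P (\<lambda>m' n'. tsum P (\<lambda>m n. f m n m' n') xs) ys"
    using xs(1)
  proof (induction xs)
    case Nil
    show ?case by (induction ys) auto
  next
    case (Cons x xs)
    have x: "fst x \<in> carrier M" "snd x \<in> carrier N" and xs: "set xs \<subseteq> carrier M \<times> carrier N"
      using Cons.prems by auto
    \<comment> \<open>Additivity of the sum over \<open>ys\<close> in its summand is what the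
      induction over \<open>xs\<close> needs.\<close>
    have "tsum P g ys \<oplus>\<^bsub>P\<^esub> tsum P h ys = tsum P (\<lambda>m n. g m n \<oplus>\<^bsub>P\<^esub> h m n) ys"
      if g: "\<And>m n. m \<in> carrier M' \<Longrightarrow> n \<in> carrier N' \<Longrightarrow> g m n \<in> carrier P" and
        h: "\<And>m n. m \<in> carrier M' \<Longrightarrow> n \<in> carrier N' \<Longrightarrow> h m n \<in> carrier P" for g h
      using ys(1)
    proof (induction ys)
      case Nil
      then show ?case by simp
    next
      case (Cons y ys)
      then have "fst y \<in> carrier M'" "snd y \<in> carrier N'" "set ys \<subseteq> carrier M' \<times> carrier N'" by auto
      then show ?case
        using Cons.IH[symmetric] tsum_closed'[OF mods(3,4) mods(5), of ys g]
          tsum_closed'[OF mods(3,4) mods(5), of ys h] g h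
        by (simp add: P.a_ac)
    qed
    from this[of "f (fst x) (snd x)" "\<lambda>m' n'. tsum P (\<lambda>m n. f m n m' n') xs"]
    show ?case
      using Cons.IH[OF xs] x xs f tsum_closed'[OF mods(1,2,5) xs] by simp
  qed
  with xs ys show ?thesis by simp
qed

end

section \<open>Sweedler calculus in a Hopf algebra\<close>

context unital_algebra
begin

lemma is_module [linear]: "module K A" ..

lemma mult_closed [linear]: "x \<in> carrier A \<Longrightarrow> y \<in> carrier A \<Longrightarrow> x \<otimes>\<^bsub>A\<^esub> y \<in> carrier A"
  by (rule m_closed)

lemma unit_closed [linear]: "\<one>\<^bsub>A\<^esub> \<in> carrier A"
  by (rule one_closed)

lemma mult_assoc:
  "x \<in> carrier A \<Longrightarrow> y \<in> carrier A \<Longrightarrow> z \<in> carrier A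
    \<Longrightarrow> x \<otimes>\<^bsub>A\<^esub> y \<otimes>\<^bsub>A\<^esub> z = x \<otimes>\<^bsub>A\<^esub> (y \<otimes>\<^bsub>A\<^esub> z)"
  by (rule m_assoc)

lemma mult_unit [simp]: "x \<in> carrier A \<Longrightarrow> \<one>\<^bsub>A\<^esub> \<otimes>\<^bsub>A\<^esub> x = x" "x \<in> carrier A \<Longrightarrow> x \<otimes>\<^bsub>A\<^esub> \<one>\<^bsub>A\<^esub> = x"
  by simp_all

lemma linear_mult_left [linear]:
  "linear_map K Q A g \<Longrightarrow> y \<in> carrier A \<Longrightarrow> linear_map K Q A (\<lambda>x. g x \<otimes>\<^bsub>A\<^esub> y)"
  by (rule R.linear_bilinear_left[OF bilinear_mult])

lemma linear_mult_right [linear]: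
  "linear_map K Q A g \<Longrightarrow> y \<in> carrier A \<Longrightarrow> linear_map K Q A (\<lambda>x. y \<otimes>\<^bsub>A\<^esub> g x)"
  by (rule R.linear_bilinear_right[OF bilinear_mult])

lemma smult_mult:
  assumes "c \<in> carrier K" "x \<in> carrier A" "y \<in> carrier A"
  shows "(c \<odot>\<^bsub>A\<^esub> x) \<otimes>\<^bsub>A\<^esub> y = c \<odot>\<^bsub>A\<^esub> (x \<otimes>\<^bsub>A\<^esub> y)" "x \<otimes>\<^bsub>A\<^esub> (c \<odot>\<^bsub>A\<^esub> y) = c \<odot>\<^bsub>A\<^esub> (x \<otimes>\<^bsub>A\<^esub> y)"
  using assms bilinear_mult by (auto simp: bilinear_map_def linear_map_def)

end

context hopf_algebra
begin

abbreviation hsum where "hsum P f h \<equiv> tensor_sum H H P f (comult H h)"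

lemma comult_closed [linear]: "h \<in> carrier H \<Longrightarrow> comult H h \<in> carrier (tensor K H H)"
  by (rule linear_mapD(1)[OF comult_linear])

lemma antipode_closed [linear]: "h \<in> carrier H \<Longrightarrow> antipode H h \<in> carrier H"
  by (rule linear_mapD(1)[OF antipode_linear])

lemma counit_closed [linear]: "h \<in> carrier H \<Longrightarrow> counit H h \<in> carrier K"
  by (rule ring_hom_closed[OF counit_hom])

lemma linear_comult [linear]:
  "linear_map K Q H g \<Longrightarrow> linear_map K Q (tensor K H H) (\<lambda>x. comult H (g x))"
  by (rule linear_comp[OF comult_linear])

lemma linear_antipode [linear]: "linear_map K Q H g \<Longrightarrow> linear_map K Q H (\<lambda>x. antipode H (g x))"
  by (rule linear_comp[OF antipode_linear])

lemma linear_counit [linear]: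
  assumes P: "module K P" and g: "linear_map K Q H g" and y: "y \<in> carrier P"
  shows "linear_map K Q P (\<lambda>x. counit H (g x) \<odot>\<^bsub>P\<^esub> y)"
proof -
  interpret P: module K P by fact
  show ?thesis
    using y by (intro linear_mapI)
      (simp_all add: linear_mapD[OF g] counit_closed counit_smult ring_hom_add[OF counit_hom]
        P.smult_l_distr P.smult_assoc1)
qed

text \<open>The axiom lives in \<open>H \<otimes> (H \<otimes> H)\<close>; the linear map
  \<open>G\<close> evaluates the trilinear \<open>F\<close> there, and applying it to both sides
  gives the rule. Read from left to right it turns left-nested sums into right-nested ones, which
  serve as the normal form.\<close>

lemma hsum_coassoc:
  assumes [linear]: "module K P"
    and "\<And>y z. y \<in> carrier H \<Longrightarrow> z \<in> carrier H \<Longrightarrow> linear_map K H P (\<lambda>x. F x y z)"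
      "\<And>x z. x \<in> carrier H \<Longrightarrow> z \<in> carrier H \<Longrightarrow> linear_map K H P (\<lambda>y. F x y z)"
      "\<And>x y. x \<in> carrier H \<Longrightarrow> y \<in> carrier H \<Longrightarrow> linear_map K H P (\<lambda>z. F x y z)"
    and h: "h \<in> carrier H"
  shows "hsum P (\<lambda>g z. hsum P (\<lambda>x y. F x y z) g) h = hsum P (\<lambda>x g. hsum P (\<lambda>y z. F x y z) g) h"
proof -
  let ?T = "tensor K H (tensor K H H)"
  let ?t = "tens K H (tensor K H H)"
  define G where "G = tensor_sum H (tensor K H H) P (\<lambda>x Y. tensor_sum H H P (\<lambda>y z. F x y z) Y)"
  note lin = linear assms(2-4)
  have G: "linear_map K ?T P G"
    unfolding G_def by (simp add: lin)
  have Gt: "G (?t x Y) = tensor_sum H H P (\<lambda>y z. F x y z) Y"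
    if "x \<in> carrier H" "Y \<in> carrier (tensor K H H)" for x Y
    unfolding G_def using that by (subst tensor_sum_tens) (simp_all add: lin)
  note pull = tensor_sum_linear[OF _ _ _ _ G]
  have "G (sweedler3 ?T H (\<lambda>x y z. ?t x (tens K H H y z)) h) =
      G (hsum ?T (\<lambda>g z. hsum ?T (\<lambda>x y. ?t x (tens K H H y z)) g) h)"
    unfolding sweedler3_def sweedler2_def
    by (rule arg_cong[of _ _ G], intro tlift_eq_tensor_sum) (simp_all add: linear h)
  also have "\<dots> = hsum P (\<lambda>g z. hsum P (\<lambda>x y. F x y z) g) h"
    by (simp add: pull linear h Gt tensor_sum_tens lin)
  finally have 1: "G (sweedler3 ?T H (\<lambda>x y z. ?t x (tens K H H y z)) h) = \<dots>" .
  have "G (sweedler2 ?T H (\<lambda>x y. ?t x (comult H y)) h) = G (hsum ?T (\<lambda>x y. ?t x (comult H y)) h)"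
    unfolding sweedler2_def
    by (rule arg_cong[of _ _ G], intro tlift_eq_tensor_sum) (simp_all add: linear h)
  also have "\<dots> = hsum P (\<lambda>x g. hsum P (\<lambda>y z. F x y z) g) h"
    by (simp add: pull linear h Gt)
  finally show ?thesis using 1 coassoc[OF h] by simp
qed

text \<open>The axiom is an identity in \<open>H\<close>. Pushing it through an arbitrary linear
  \<open>F\<close> makes it a cancellation rule inside any expression linear in the component; the
  next three lemmas follow the same pattern.\<close>

lemma hsum_counit_left:
  assumes P: "module K P" and F: "linear_map K H P F" and h: "h \<in> carrier H"
  shows "hsum P (\<lambda>x y. counit H x \<odot>\<^bsub>P\<^esub> F y) h = F h"
proof -
  have "F h = F (hsum H (\<lambda>x y. counit H x \<odot>\<^bsub>H\<^esub> y) h)"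
    using counit_left[OF h] h by (simp add: sweedler2_def tensor_sum_eq_tlift linear)
  also have "\<dots> = hsum P (\<lambda>x y. F (counit H x \<odot>\<^bsub>H\<^esub> y)) h"
    by (rule tensor_sum_linear) (simp_all add: linear P F h)
  also have "\<dots> = hsum P (\<lambda>x y. counit H x \<odot>\<^bsub>P\<^esub> F y) h"
    by (simp add: linear_mapD(3)[OF F] linear)
  finally show ?thesis ..
qed

lemma hsum_counit_right:
  assumes P: "module K P" and F: "linear_map K H P F" and h: "h \<in> carrier H"
  shows "hsum P (\<lambda>x y. counit H y \<odot>\<^bsub>P\<^esub> F x) h = F h"
proof -
  have "F h = F (hsum H (\<lambda>x y. counit H y \<odot>\<^bsub>H\<^esub> x) h)"
    using counit_right[OF h] h by (simp add: sweedler2_def tensor_sum_eq_tlift linear)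
  also have "\<dots> = hsum P (\<lambda>x y. F (counit H y \<odot>\<^bsub>H\<^esub> x)) h"
    by (rule tensor_sum_linear) (simp_all add: linear P F h)
  also have "\<dots> = hsum P (\<lambda>x y. counit H y \<odot>\<^bsub>P\<^esub> F x) h"
    by (simp add: linear_mapD(3)[OF F] linear)
  finally show ?thesis ..
qed

lemma hsum_antipode_left:
  assumes P: "module K P" and F: "linear_map K H P F" and h: "h \<in> carrier H"
  shows "hsum P (\<lambda>x y. F (antipode H x \<otimes>\<^bsub>H\<^esub> y)) h = counit H h \<odot>\<^bsub>P\<^esub> F \<one>\<^bsub>H\<^esub>"
proof -
  have "hsum P (\<lambda>x y. F (antipode H x \<otimes>\<^bsub>H\<^esub> y)) h = F (hsum H (\<lambda>x y. antipode H x \<otimes>\<^bsub>H\<^esub> y) h)"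
    by (rule tensor_sum_linear[symmetric]) (simp_all add: linear P F h)
  also have "hsum H (\<lambda>x y. antipode H x \<otimes>\<^bsub>H\<^esub> y) h = counit H h \<odot>\<^bsub>H\<^esub> \<one>\<^bsub>H\<^esub>"
    using antipode_left[OF h] h by (simp add: sweedler2_def tensor_sum_eq_tlift linear)
  finally show ?thesis by (simp add: linear_mapD(3)[OF F] linear h)
qed

lemma hsum_antipode_right:
  assumes P: "module K P" and F: "linear_map K H P F" and h: "h \<in> carrier H"
  shows "hsum P (\<lambda>x y. F (x \<otimes>\<^bsub>H\<^esub> antipode H y)) h = counit H h \<odot>\<^bsub>P\<^esub> F \<one>\<^bsub>H\<^esub>"
proof -
  have "hsum P (\<lambda>x y. F (x \<otimes>\<^bsub>H\<^esub> antipode H y)) h = F (hsum H (\<lambda>x y. x \<otimes>\<^bsub>H\<^esub> antipode H y) h)"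
    by (rule tensor_sum_linear[symmetric]) (simp_all add: linear P F h)
  also have "hsum H (\<lambda>x y. x \<otimes>\<^bsub>H\<^esub> antipode H y) h = counit H h \<odot>\<^bsub>H\<^esub> \<one>\<^bsub>H\<^esub>"
    using antipode_right[OF h] h by (simp add: sweedler2_def tensor_sum_eq_tlift linear)
  finally show ?thesis by (simp add: linear_mapD(3)[OF F] linear h)
qed

text \<open>Multiplicativity of the coproduct, evaluated by the linear map that the bilinear
  \<open>F\<close> induces on \<open>H \<otimes> H\<close>.\<close>

lemma hsum_mult:
  assumes [linear]: "module K P"
    and F: "\<And>x. x \<in> carrier H \<Longrightarrow> linear_map K H P (\<lambda>y. F x y)"
      "\<And>y. y \<in> carrier H \<Longrightarrow> linear_map K H P (\<lambda>x. F x y)"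
    and gh: "g \<in> carrier H" "h \<in> carrier H"
  shows "hsum P F (g \<otimes>\<^bsub>H\<^esub> h) =
    hsum P (\<lambda>x y. hsum P (\<lambda>x' y'. F (x \<otimes>\<^bsub>H\<^esub> x') (y \<otimes>\<^bsub>H\<^esub> y')) h) g"
proof -
  let ?T = "tensor K H H"
  have G: "linear_map K ?T P (tensor_sum H H P F)"
    using F by (intro tensor_sum_linear_arg) (simp_all add: linear)
  note pull = tensor_sum_linear[OF _ _ _ _ G]
  have "comult H (g \<otimes>\<^bsub>H\<^esub> h) =
      tlift ?T (\<lambda>a u. tlift ?T (\<lambda>b v. tens K H H (a \<otimes>\<^bsub>H\<^esub> b) (u \<otimes>\<^bsub>H\<^esub> v)) (comult H h)) (comult H g)"
    using ring_hom_mult[OF comult_hom gh] by (simp add: tensor_algebra_def)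
  also have "\<dots> = hsum ?T (\<lambda>a u. hsum ?T (\<lambda>b v. tens K H H (a \<otimes>\<^bsub>H\<^esub> b) (u \<otimes>\<^bsub>H\<^esub> v)) h) g"
    by (intro tlift_eq_tensor_sum) (simp_all add: linear gh)
  finally show ?thesis
    by (simp add: pull linear gh tensor_sum_tens F)
qed

lemma comult_one: "comult H \<one>\<^bsub>H\<^esub> = tens K H H \<one>\<^bsub>H\<^esub> \<one>\<^bsub>H\<^esub>"
  using ring_hom_one[OF comult_hom] by (simp add: tensor_algebra_def)

lemma hsum_one:
  assumes [linear]: "module K P"
    and F: "\<And>x. x \<in> carrier H \<Longrightarrow> linear_map K H P (\<lambda>y. F x y)"
      "\<And>y. y \<in> carrier H \<Longrightarrow> linear_map K H P (\<lambda>x. F x y)"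
  shows "hsum P F \<one>\<^bsub>H\<^esub> = F \<one>\<^bsub>H\<^esub> \<one>\<^bsub>H\<^esub>"
  unfolding comult_one by (subst tensor_sum_tens) (simp_all add: linear F)

section \<open>The antipode reverses products and fixes the unit\<close>

lemma antipode_one: "antipode H \<one>\<^bsub>H\<^esub> = \<one>\<^bsub>H\<^esub>"
proof -
  interpret ring H ..
  have "hsum H (\<lambda>x y. antipode H x \<otimes>\<^bsub>H\<^esub> y) \<one>\<^bsub>H\<^esub> = \<one>\<^bsub>H\<^esub>"
    using hsum_antipode_left[OF is_module linear_id one_closed] ring_hom_one[OF counit_hom]
    by simp
  then show ?thesis by (subst (asm) hsum_one) (simp_all add: linear)
qed

text \<open>The factors on the right are exchanged so that, once the scalars are split, the one
  belonging to \<open>h\<close> stands outermost, where the inner sum over the coproduct of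
  \<open>h\<close> absorbs it.\<close>

lemma counit_mult: "g \<in> carrier H \<Longrightarrow> h \<in> carrier H
    \<Longrightarrow> counit H (g \<otimes>\<^bsub>H\<^esub> h) = counit H h \<otimes>\<^bsub>K\<^esub> counit H g"
  by (simp add: ring_hom_mult[OF counit_hom] counit_closed m_comm)

text \<open>Both sides are computed from the sum of
  \<open>S(g\<^sub>0 h\<^sub>0) g\<^sub>1 h\<^sub>1 S(h\<^sub>2) S(g\<^sub>2)\<close>, by cancelling its right or its left half.\<close>

lemma antipode_mult:
  assumes g: "g \<in> carrier H" and h: "h \<in> carrier H"
  shows "antipode H (g \<otimes>\<^bsub>H\<^esub> h) = antipode H h \<otimes>\<^bsub>H\<^esub> antipode H g"
proof -
  let ?S = "antipode H"
  note simps = linear g h mult_assoc smult_mult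
  have R: "hsum H (\<lambda>x y. c \<otimes>\<^bsub>H\<^esub> (d \<otimes>\<^bsub>H\<^esub> (x \<otimes>\<^bsub>H\<^esub> (?S y \<otimes>\<^bsub>H\<^esub> e)))) k = counit H k \<odot>\<^bsub>H\<^esub> (c \<otimes>\<^bsub>H\<^esub> (d \<otimes>\<^bsub>H\<^esub> e))"
    if "c \<in> carrier H" "d \<in> carrier H" "e \<in> carrier H" "k \<in> carrier H" for c d e k
    using hsum_antipode_right[of H "\<lambda>z. c \<otimes>\<^bsub>H\<^esub> (d \<otimes>\<^bsub>H\<^esub> (z \<otimes>\<^bsub>H\<^esub> e))" k] that by (simp add: simps)
  have R': "hsum H (\<lambda>x y. c \<otimes>\<^bsub>H\<^esub> (x \<otimes>\<^bsub>H\<^esub> ?S y)) k = counit H k \<odot>\<^bsub>H\<^esub> c"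
    if "c \<in> carrier H" "k \<in> carrier H" for c k
    using hsum_antipode_right[of H "\<lambda>z. c \<otimes>\<^bsub>H\<^esub> z" k] that by (simp add: simps)
  have L: "hsum H (\<lambda>x y. ?S x \<otimes>\<^bsub>H\<^esub> (y \<otimes>\<^bsub>H\<^esub> e)) k = counit H k \<odot>\<^bsub>H\<^esub> e"
    if "e \<in> carrier H" "k \<in> carrier H" for e k
    using hsum_antipode_left[of H "\<lambda>z. z \<otimes>\<^bsub>H\<^esub> e" k] that by (simp add: simps)
  let ?F = "\<lambda>x y z x' y' z'. ?S (x \<otimes>\<^bsub>H\<^esub> x') \<otimes>\<^bsub>H\<^esub> (y \<otimes>\<^bsub>H\<^esub> (y' \<otimes>\<^bsub>H\<^esub> (?S z' \<otimes>\<^bsub>H\<^esub> ?S z)))"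
  define W where "W = hsum H (\<lambda>x k. hsum H (\<lambda>y z. hsum H (\<lambda>x' k'. hsum H (\<lambda>y' z'. ?F x y z x' y' z') k') h) k) g"
  \<comment> \<open>The components \<open>y'\<close> and \<open>S(z')\<close> of \<open>h\<close>
    are adjacent and cancel for fixed components of \<open>g\<close>; those of \<open>g\<close> then
    become adjacent in turn.\<close>
  have "W = hsum H (\<lambda>x k. hsum H (\<lambda>y z. ?S (x \<otimes>\<^bsub>H\<^esub> h) \<otimes>\<^bsub>H\<^esub> (y \<otimes>\<^bsub>H\<^esub> ?S z)) k) g"
    unfolding W_def
    by (simp add: R simps hsum_counit_right[where F = "\<lambda>x. ?S (y \<otimes>\<^bsub>H\<^esub> x) \<otimes>\<^bsub>H\<^esub> z" for y z])
  also have "\<dots> = ?S (g \<otimes>\<^bsub>H\<^esub> h)"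
    by (simp add: R' simps hsum_counit_right[where F = "\<lambda>x. ?S (x \<otimes>\<^bsub>H\<^esub> h)"])
  finally have 1: "W = ?S (g \<otimes>\<^bsub>H\<^esub> h)" .
  \<comment> \<open>Coassociativity regroups the legs so that the first two of \<open>g\<close> form
    the coproduct of one element \<open>k\<close>, and likewise for \<open>h\<close>. After the
    interchange the two inner sums merge into the coproduct of the product of \<open>k\<close> and
    \<open>k'\<close>.\<close>
  have "W = hsum H (\<lambda>k z. hsum H (\<lambda>x y. hsum H (\<lambda>k' z'. hsum H (\<lambda>x' y'. ?F x y z x' y' z') k') h) k) g"
    unfolding W_def by (simp add: hsum_coassoc[symmetric] simps)
  also have "\<dots> = hsum H (\<lambda>k z. hsum H (\<lambda>k' z'. hsum H (\<lambda>x y. hsum H (\<lambda>x' y'. ?F x y z x' y' z') k') k) h) g"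
    by (simp add: tensor_sum_swap[where X = "comult H k" and Y = "comult H h" for k] simps)
  also have "\<dots> = hsum H (\<lambda>k z. hsum H (\<lambda>k' z'. hsum H (\<lambda>x y. ?S x \<otimes>\<^bsub>H\<^esub> (y \<otimes>\<^bsub>H\<^esub> (?S z' \<otimes>\<^bsub>H\<^esub> ?S z))) (k \<otimes>\<^bsub>H\<^esub> k')) h) g"
    by (simp add: hsum_mult simps)
  also have "\<dots> = hsum H (\<lambda>k z. hsum H (\<lambda>k' z'. counit H k' \<odot>\<^bsub>H\<^esub> (counit H k \<odot>\<^bsub>H\<^esub> (?S z' \<otimes>\<^bsub>H\<^esub> ?S z))) h) g"
    by (simp add: L simps counit_mult smult_assoc1)
  also have "\<dots> = hsum H (\<lambda>k z. counit H k \<odot>\<^bsub>H\<^esub> (?S h \<otimes>\<^bsub>H\<^esub> ?S z)) g"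
    by (simp add: simps hsum_counit_left[where F = "\<lambda>x. c \<odot>\<^bsub>H\<^esub> (?S x \<otimes>\<^bsub>H\<^esub> z)" for c z])
  also have "\<dots> = ?S h \<otimes>\<^bsub>H\<^esub> ?S g"
    by (simp add: simps hsum_counit_left[where F = "\<lambda>x. ?S h \<otimes>\<^bsub>H\<^esub> ?S x"])
  finally show ?thesis using 1 by simp
qed

end

section \<open>Algebra structures on a tensor product\<close>

text \<open>The module axioms constrain only addition and scalar multiplication, so the fields left
  undefined by \<open>tensor\<close> can be set freely.\<close>

lemma module_update:
  assumes "module K T"
  shows "module K (T\<lparr>mult := m, one := e\<rparr>)"
proof -
  interpret module K T by fact
  show ?thesis
    by (rule moduleI, unfold_locales)
      (auto simp: smult_l_distr smult_r_distr smult_assoc1 M.a_ac Units_def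
        intro: exI[of _ "\<ominus>\<^bsub>T\<^esub> x" for x] M.l_neg M.r_neg)
qed

lemma linear_map_update [simp]:
  "linear_map K (T\<lparr>mult := m, one := e\<rparr>) Q f \<longleftrightarrow> linear_map K T Q f"
  "linear_map K Q (T\<lparr>mult := m, one := e\<rparr>) g \<longleftrightarrow> linear_map K Q T g"
  by (simp_all add: linear_map_def)

text \<open>Distributivity is additivity of \<open>m\<close> in each argument, so a bilinear
  \<open>m\<close> leaves only associativity and the unit laws to be supplied.\<close>

lemma unital_algebra_updateI:
  assumes T: "module K T"
    and m: "\<And>x. x \<in> carrier T \<Longrightarrow> linear_map K T T (\<lambda>y. m x y)"
      "\<And>y. y \<in> carrier T \<Longrightarrow> linear_map K T T (\<lambda>x. m x y)"
    and e: "e \<in> carrier T"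
    and assoc: "\<And>x y z. x \<in> carrier T \<Longrightarrow> y \<in> carrier T \<Longrightarrow> z \<in> carrier T
      \<Longrightarrow> m (m x y) z = m x (m y z)"
    and unit: "\<And>x. x \<in> carrier T \<Longrightarrow> m e x = x" "\<And>x. x \<in> carrier T \<Longrightarrow> m x e = x"
  shows "unital_algebra K (T\<lparr>mult := m, one := e\<rparr>)"
proof -
  let ?B = "T\<lparr>mult := m, one := e\<rparr>"
  interpret B: module K ?B by (rule module_update[OF T])
  have "ring ?B"
  proof (rule ringI)
    show "abelian_group ?B" ..
    show "monoid ?B"
      by (rule monoidI) (simp_all add: e assoc unit linear_mapD(1)[OF m(1)])
  qed (simp_all add: linear_mapD(2)[OF m(1)] linear_mapD(2)[OF m(2)])
  then show ?thesis
    using m B.module_axioms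
    by (simp add: unital_algebra_def unital_algebra_axioms_def bilinear_map_def)
qed

context cring
begin

context
  fixes A :: "('a, 'm, 'x) module_scheme" and B :: "('a, 'n, 'y) module_scheme"
  assumes A: "unital_algebra R A" and B: "unital_algebra R B"
begin

interpretation A: unital_algebra R A by (rule A)
interpretation B: unital_algebra R B by (rule B)

lemma tensor_algebra_mult:
  assumes "X \<in> carrier (tensor R A B)" "Y \<in> carrier (tensor R A B)"
  shows "X \<otimes>\<^bsub>tensor_algebra R A B\<^esub> Y = tensor_sum A B (tensor R A B)
    (\<lambda>a u. tensor_sum A B (tensor R A B) (\<lambda>b v. tens R A B (a \<otimes>\<^bsub>A\<^esub> b) (u \<otimes>\<^bsub>B\<^esub> v)) Y) X"
  unfolding tensor_algebra_def
  by (simp, intro tlift_eq_tensor_sum) (simp_all add: linear assms)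

lemma tensor_algebra_mult_tens:
  assumes "a \<in> carrier A" "u \<in> carrier B" "b \<in> carrier A" "v \<in> carrier B"
  shows "tens R A B a u \<otimes>\<^bsub>tensor_algebra R A B\<^esub> tens R A B b v = tens R A B (a \<otimes>\<^bsub>A\<^esub> b) (u \<otimes>\<^bsub>B\<^esub> v)"
  using assms by (simp add: tensor_algebra_mult linear tensor_sum_tens)

text \<open>On the carrier the product equals a nested sum, whose linearity follows from the rules
  in \<open>linear\<close>; \<open>linear_map_cong\<close> makes the replacement. The same device
  serves for \<open>bar\<close>, \<open>adj\<close>, \<open>braid\<close> and
  \<open>diag\<close>.\<close>

lemma linear_tensor_algebra_mult:
  assumes [linear]: "X \<in> carrier (tensor R A B)"
  shows "linear_map R (tensor R A B) (tensor R A B) (\<lambda>Y. X \<otimes>\<^bsub>tensor_algebra R A B\<^esub> Y)"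
    "linear_map R (tensor R A B) (tensor R A B) (\<lambda>Y. Y \<otimes>\<^bsub>tensor_algebra R A B\<^esub> X)"
  by (subst linear_map_cong, simp add: linear, erule tensor_algebra_mult[OF assms], simp add: linear)
    (subst linear_map_cong, simp add: linear, erule tensor_algebra_mult[OF _ assms], simp add: linear)

lemmas linear_tensor_algebra_mult' =
  linear_comp[OF linear_tensor_algebra_mult(1)] linear_comp[OF linear_tensor_algebra_mult(2)]

lemma tensor_algebra_unital: "unital_algebra R (tensor_algebra R A B)"
proof -
  let ?T = "tensor R A B"
  \<comment> \<open>Naming the product puts the algebra into the record-update form that
    \<open>unital_algebra_updateI\<close> expects, while the rules known for the product carry over
    by folding.\<close>
  define m where "m X Y = X \<otimes>\<^bsub>tensor_algebra R A B\<^esub> Y" for X Y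
  have eq: "tensor_algebra R A B = ?T\<lparr>mult := m, one := tens R A B \<one>\<^bsub>A\<^esub> \<one>\<^bsub>B\<^esub>\<rparr>"
    by (simp add: m_def[abs_def] tensor_algebra_def)
  note mt = tensor_algebra_mult_tens[folded m_def]
  note [linear] = linear_tensor_algebra_mult'[folded m_def]
  have [linear]: "m X Y \<in> carrier ?T" if "X \<in> carrier ?T" "Y \<in> carrier ?T" for X Y
    unfolding m_def using that by (rule linear_mapD(1)[OF linear_tensor_algebra_mult(1)])
  show ?thesis
    unfolding eq
  proof (rule unital_algebra_updateI)
    fix X Y Z assume [linear]: "X \<in> carrier ?T" "Y \<in> carrier ?T" "Z \<in> carrier ?T"
    note ext = tensor_linear_eqI[OF A.is_module B.is_module, where P = ?T]
    show "m (m X Y) Z = m X (m Y Z)"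
    proof (rule ext[where X = X])
      fix a u assume [linear]: "a \<in> carrier A" "u \<in> carrier B"
      show "m (m (tens R A B a u) Y) Z = m (tens R A B a u) (m Y Z)"
      proof (rule ext[where X = Y])
        fix b v assume [linear]: "b \<in> carrier A" "v \<in> carrier B"
        show "m (m (tens R A B a u) (tens R A B b v)) Z = m (tens R A B a u) (m (tens R A B b v) Z)"
          by (rule ext[where X = Z]) (simp_all add: linear mt A.mult_assoc B.mult_assoc)
      qed (simp_all add: linear)
    qed (simp_all add: linear)
    show "m (tens R A B \<one>\<^bsub>A\<^esub> \<one>\<^bsub>B\<^esub>) X = X"
      by (rule ext[where X = X]) (simp_all add: linear mt)
    show "m X (tens R A B \<one>\<^bsub>A\<^esub> \<one>\<^bsub>B\<^esub>) = X"
      by (rule ext[where X = X]) (simp_all add: linear mt)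
  qed (simp_all add: linear)
qed

end

end

section \<open>The coaction of a Yetter-Drinfeld algebra\<close>

locale yetter_drinfeld_hom =
  H: hopf_algebra K H + A: yetter_drinfeld_algebra K H A act \<rho> + E: unital_algebra K E
  for K (structure) and H :: "('k, 'h, 'z) hopf_scheme" (structure) and A :: "('k, 'a, 'w) module_scheme" (structure)
    and act and \<rho> and E :: "('k, 'e, 'v) module_scheme" (structure) +
  fixes p :: "'h \<Rightarrow> 'e"
  assumes p_linear: "linear_map K H E p"
    and p_mult: "g \<in> carrier H \<Longrightarrow> h \<in> carrier H \<Longrightarrow> p (g \<otimes>\<^bsub>H\<^esub> h) = p g \<otimes>\<^bsub>E\<^esub> p h"
    and p_one: "p \<one>\<^bsub>H\<^esub> = \<one>\<^bsub>E\<^esub>"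
begin

abbreviation T where "T \<equiv> tensor K A E"
abbreviation t where "t \<equiv> tens K A E"
abbreviation S where "S \<equiv> antipode H"
abbreviation hsum where "hsum P f h \<equiv> tensor_sum H H P f (comult H h)"
abbreviation csum where "csum P f a \<equiv> tensor_sum A H P f (\<rho> a)"

lemma p_closed [linear]: "h \<in> carrier H \<Longrightarrow> p h \<in> carrier E"
  by (rule linear_mapD(1)[OF p_linear])

lemma linear_p [linear]: "linear_map K Q H g \<Longrightarrow> linear_map K Q E (\<lambda>x. p (g x))"
  by (rule H.linear_comp[OF p_linear])

lemma coact_closed [linear]: "a \<in> carrier A \<Longrightarrow> \<rho> a \<in> carrier (tensor K A H)"
  by (rule linear_mapD(1)[OF A.coact_linear])

lemma linear_coact [linear]:
  "linear_map K Q A g \<Longrightarrow> linear_map K Q (tensor K A H) (\<lambda>x. \<rho> (g x))"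
  by (rule H.linear_comp[OF A.coact_linear])

lemma act_closed [linear]: "h \<in> carrier H \<Longrightarrow> a \<in> carrier A \<Longrightarrow> act h a \<in> carrier A"
  using A.act_bilinear by (auto simp: bilinear_map_def linear_map_def)

lemma linear_act_left [linear]:
  "linear_map K Q H g \<Longrightarrow> a \<in> carrier A \<Longrightarrow> linear_map K Q A (\<lambda>x. act (g x) a)"
  by (rule H.linear_bilinear_left[OF A.act_bilinear])

lemma linear_act_right [linear]:
  "linear_map K Q A g \<Longrightarrow> h \<in> carrier H \<Longrightarrow> linear_map K Q A (\<lambda>x. act h (g x))"
  by (rule H.linear_bilinear_right[OF A.act_bilinear])

lemma act_prod_hsum:
  "h \<in> carrier H \<Longrightarrow> a \<in> carrier A \<Longrightarrow> b \<in> carrier A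
    \<Longrightarrow> act h (a \<otimes>\<^bsub>A\<^esub> b) = hsum A (\<lambda>x y. act x a \<otimes>\<^bsub>A\<^esub> act y b) h"
  by (simp add: A.act_prod sweedler2_def H.tensor_sum_eq_tlift linear)

text \<open>Coacting twice becomes one coaction followed by the coproduct of its
  \<open>H\<close>-component, the form in which the antipode rules apply. As in
  \<open>hsum_coassoc\<close>, \<open>G\<close> evaluates the axiom, here on
  \<open>A \<otimes> (H \<otimes> H)\<close>.\<close>

lemma csum_coassoc:
  assumes [linear]: "module K P"
    and "\<And>y z. y \<in> carrier H \<Longrightarrow> z \<in> carrier H \<Longrightarrow> linear_map K A P (\<lambda>x. F x y z)"
      "\<And>x z. x \<in> carrier A \<Longrightarrow> z \<in> carrier H \<Longrightarrow> linear_map K H P (\<lambda>y. F x y z)"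
      "\<And>x y. x \<in> carrier A \<Longrightarrow> y \<in> carrier H \<Longrightarrow> linear_map K H P (\<lambda>z. F x y z)"
    and a: "a \<in> carrier A"
  shows "csum P (\<lambda>b z. csum P (\<lambda>x y. F x y z) b) a = csum P (\<lambda>x g. hsum P (\<lambda>y z. F x y z) g) a"
proof -
  let ?T = "tensor K A (tensor K H H)"
  let ?t = "tens K A (tensor K H H)"
  define G where "G = tensor_sum A (tensor K H H) P (\<lambda>x Y. tensor_sum H H P (\<lambda>y z. F x y z) Y)"
  note lin = linear assms(2-4)
  have G: "linear_map K ?T P G"
    unfolding G_def by (simp add: lin)
  have Gt: "G (?t x Y) = tensor_sum H H P (\<lambda>y z. F x y z) Y"
    if "x \<in> carrier A" "Y \<in> carrier (tensor K H H)" for x Y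
    unfolding G_def using that by (subst H.tensor_sum_tens) (simp_all add: lin)
  note pull = H.tensor_sum_linear[OF _ _ _ _ G]
  have "G (tlift ?T (\<lambda>b z. tlift ?T (\<lambda>x y. ?t x (tens K H H y z)) (\<rho> b)) (\<rho> a)) =
      G (csum ?T (\<lambda>b z. csum ?T (\<lambda>x y. ?t x (tens K H H y z)) b) a)"
    by (rule arg_cong[of _ _ G], intro H.tlift_eq_tensor_sum) (simp_all add: linear a)
  also have "\<dots> = csum P (\<lambda>b z. csum P (\<lambda>x y. F x y z) b) a"
    by (simp add: pull linear a Gt H.tensor_sum_tens lin)
  finally have 1: "G (tlift ?T (\<lambda>b z. tlift ?T (\<lambda>x y. ?t x (tens K H H y z)) (\<rho> b)) (\<rho> a)) = \<dots>" .
  have "G (tlift ?T (\<lambda>x y. ?t x (comult H y)) (\<rho> a)) = G (csum ?T (\<lambda>x y. ?t x (comult H y)) a)"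
    by (rule arg_cong[of _ _ G], intro H.tlift_eq_tensor_sum) (simp_all add: linear a)
  also have "\<dots> = csum P (\<lambda>x g. hsum P (\<lambda>y z. F x y z) g) a"
    by (simp add: pull linear a Gt)
  finally show ?thesis using 1 A.coact_coassoc[OF a] by simp
qed

lemma csum_counit:
  assumes P: "module K P" and F: "linear_map K A P F" and a: "a \<in> carrier A"
  shows "csum P (\<lambda>x y. counit H y \<odot>\<^bsub>P\<^esub> F x) a = F a"
proof -
  have "F a = F (csum A (\<lambda>x y. counit H y \<odot>\<^bsub>A\<^esub> x) a)"
    using A.coact_counit[OF a] a by (simp add: H.tensor_sum_eq_tlift linear)
  also have "\<dots> = csum P (\<lambda>x y. F (counit H y \<odot>\<^bsub>A\<^esub> x)) a"
    by (rule H.tensor_sum_linear) (simp_all add: linear P F a)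
  also have "\<dots> = csum P (\<lambda>x y. counit H y \<odot>\<^bsub>P\<^esub> F x) a"
    by (simp add: linear_mapD(3)[OF F] linear)
  finally show ?thesis ..
qed

text \<open>The component of \<open>b\<close> precedes that of \<open>a\<close> in \<open>H\<close>,
  the coaction being one over the opposite algebra. The braided product yields the same order, which
  makes \<Phi> multiplicative.\<close>

lemma csum_mult:
  assumes [linear]: "module K P"
    and F: "\<And>x. x \<in> carrier A \<Longrightarrow> linear_map K H P (\<lambda>y. F x y)"
      "\<And>y. y \<in> carrier H \<Longrightarrow> linear_map K A P (\<lambda>x. F x y)"
    and ab: "a \<in> carrier A" "b \<in> carrier A"
  shows "csum P F (a \<otimes>\<^bsub>A\<^esub> b) =
    csum P (\<lambda>x y. csum P (\<lambda>x' y'. F (x \<otimes>\<^bsub>A\<^esub> x') (y' \<otimes>\<^bsub>H\<^esub> y)) b) a"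
proof -
  let ?T = "tensor K A H"
  have G: "linear_map K ?T P (tensor_sum A H P F)"
    using F by (intro H.tensor_sum_linear_arg) (simp_all add: linear)
  note pull = H.tensor_sum_linear[OF _ _ _ _ G]
  have "\<rho> (a \<otimes>\<^bsub>A\<^esub> b) = csum ?T (\<lambda>x y. csum ?T (\<lambda>x' y'. tens K A H (x \<otimes>\<^bsub>A\<^esub> x') (y' \<otimes>\<^bsub>H\<^esub> y)) b) a"
    unfolding A.coact_mult[OF ab] by (intro H.tlift_eq_tensor_sum) (simp_all add: linear ab)
  then show ?thesis
    by (simp add: pull linear ab H.tensor_sum_tens F)
qed

lemma csum_one:
  assumes [linear]: "module K P"
    and F: "\<And>x. x \<in> carrier A \<Longrightarrow> linear_map K H P (\<lambda>y. F x y)"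
      "\<And>y. y \<in> carrier H \<Longrightarrow> linear_map K A P (\<lambda>x. F x y)"
  shows "csum P F \<one>\<^bsub>A\<^esub> = F \<one>\<^bsub>A\<^esub> \<one>\<^bsub>H\<^esub>"
  unfolding A.coact_one by (subst H.tensor_sum_tens) (simp_all add: linear F)

lemma hsum_csum_yetter_drinfeld:
  assumes [linear]: "module K P"
    and F: "\<And>x. x \<in> carrier A \<Longrightarrow> linear_map K H P (\<lambda>y. F x y)"
      "\<And>y. y \<in> carrier H \<Longrightarrow> linear_map K A P (\<lambda>x. F x y)"
    and ha: "h \<in> carrier H" "a \<in> carrier A"
  shows "hsum P (\<lambda>x y. csum P (\<lambda>b c. F b (c \<otimes>\<^bsub>H\<^esub> x)) (act y a)) h =
    hsum P (\<lambda>x y. csum P (\<lambda>b c. F (act x b) (y \<otimes>\<^bsub>H\<^esub> c)) a) h"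
proof -
  let ?T = "tensor K A H"
  have G: "linear_map K ?T P (tensor_sum A H P F)"
    using F by (intro H.tensor_sum_linear_arg) (simp_all add: linear)
  note pull = H.tensor_sum_linear[OF _ _ _ _ G]
  have 1: "sweedler2 ?T H (\<lambda>h0 h1. tlift ?T (\<lambda>b0 b1. tens K A H b0 (b1 \<otimes>\<^bsub>H\<^esub> h0)) (\<rho> (act h1 a))) h =
    hsum ?T (\<lambda>x y. csum ?T (\<lambda>b c. tens K A H b (c \<otimes>\<^bsub>H\<^esub> x)) (act y a)) h"
    unfolding sweedler2_def
    by (intro H.tlift_eq_tensor_sum) (simp_all add: linear ha)
  note 1[symmetric]
  also have "sweedler2 ?T H (\<lambda>h0 h1. tlift ?T (\<lambda>b0 b1. tens K A H b0 (b1 \<otimes>\<^bsub>H\<^esub> h0)) (\<rho> (act h1 a))) h = sweedler2 ?T H (\<lambda>h0 h1. tlift ?T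
        (\<lambda>a0 a1. tens K A H (act h0 a0) (h1 \<otimes>\<^bsub>H\<^esub> a1)) (\<rho> a)) h"
    by (rule A.yetter_drinfeld[OF ha])
  also have "\<dots> = hsum ?T (\<lambda>x y. csum ?T (\<lambda>b c. tens K A H (act x b) (y \<otimes>\<^bsub>H\<^esub> c)) a) h"
    unfolding sweedler2_def
    by (intro H.tlift_eq_tensor_sum) (simp_all add: linear ha)
  finally have "tensor_sum A H P F (hsum ?T (\<lambda>x y. csum ?T (\<lambda>b c. tens K A H b (c \<otimes>\<^bsub>H\<^esub> x)) (act y a)) h) =
    tensor_sum A H P F (hsum ?T (\<lambda>x y. csum ?T (\<lambda>b c. tens K A H (act x b) (y \<otimes>\<^bsub>H\<^esub> c)) a) h)"
    by simp
  then show ?thesis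
    by (simp add: pull linear ha H.tensor_sum_tens F)
qed

end

section \<open>The two structures and the isomorphism\<close>

text \<open>Surjectivity writes every element of \<open>C\<close> as \<open>f x\<close>, and
  \<open>pull\<close> moves all operations under \<open>f\<close>, so each axiom for
  \<open>C\<close> is the image of the same axiom for \<open>B\<close>. In the product rule
  \<open>f\<close> must also pass through the Sweedler sum, hence the separate fact
  \<open>3\<close>.\<close>

lemma (in hopf_algebra) H_algebra_transport:
  assumes B: "H_algebra K H B act" and C: "module K C"
    and f: "linear_map K B C f" "f ` carrier B = carrier C"
    and f_mult: "\<And>x y. x \<in> carrier B \<Longrightarrow> y \<in> carrier B \<Longrightarrow> f (x \<otimes>\<^bsub>B\<^esub> y) = f x \<otimes>\<^bsub>C\<^esub> f y"
    and f_one: "f \<one>\<^bsub>B\<^esub> = \<one>\<^bsub>C\<^esub>"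
    and f_act: "\<And>h x. h \<in> carrier H \<Longrightarrow> x \<in> carrier B \<Longrightarrow> f (act h x) = act' h (f x)"
  shows "H_algebra K H C act'"
proof -
  interpret B: H_algebra K H B act by fact
  interpret C: module K C by fact
  note image = f(2)[symmetric]
  note pull = f_mult[symmetric] f_act[symmetric] linear_mapD(2,3)[OF f(1), symmetric] f_one[symmetric]
  have act_closed: "act h x \<in> carrier B" if "h \<in> carrier H" "x \<in> carrier B" for h x
    using that B.act_bilinear by (auto simp: bilinear_map_def linear_map_def)
  note closed = act_closed linear_mapD(1)[OF f(1)] B.mult_closed B.unit_closed
  have "ring C"
  proof (rule ringI)
    show "abelian_group C" ..
    show "monoid C"
      by (rule monoidI) (auto simp: image pull closed B.mult_assoc)
  qed (auto simp: image pull closed B.l_distr B.r_distr)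
  moreover have "bilinear_map K C C C (\<lambda>x y. x \<otimes>\<^bsub>C\<^esub> y)"
    by (auto simp: image bilinear_map_def linear_map_def pull closed B.l_distr B.r_distr B.smult_mult)
  ultimately have 1: "unital_algebra K C"
    using C by (simp add: unital_algebra_def unital_algebra_axioms_def)
  have "bilinear_map K H C C act'"
    using B.act_bilinear
    by (auto simp: image bilinear_map_def linear_map_def pull closed)
  then have 2: "representation K H C act'"
    using C by (auto simp: representation_def representation_axioms_def image pull closed B.act_mult B.act_one linear)
  have 3: "act' h (f x \<otimes>\<^bsub>C\<^esub> f y) = sweedler2 C H (\<lambda>g k. act' g (f x) \<otimes>\<^bsub>C\<^esub> act' k (f y)) h"
    if xy: "x \<in> carrier B" "y \<in> carrier B" and h: "h \<in> carrier H" for x y h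
  proof -
    have "act' h (f x \<otimes>\<^bsub>C\<^esub> f y) = f (hsum B (\<lambda>g k. act g x \<otimes>\<^bsub>B\<^esub> act k y) h)"
      using xy h by (simp add: pull closed B.act_prod sweedler2_def tensor_sum_eq_tlift linear)
    also have "\<dots> = hsum C (\<lambda>g k. f (act g x \<otimes>\<^bsub>B\<^esub> act k y)) h"
      using xy h f by (intro tensor_sum_linear) (simp_all add: linear closed C B.is_module)
    also have "\<dots> = hsum C (\<lambda>g k. act' g (f x) \<otimes>\<^bsub>C\<^esub> act' k (f y)) h"
      using xy by (simp add: f_mult f_act closed)
    finally show ?thesis using h by (simp add: sweedler2_def tensor_sum_eq_tlift linear)
  qed
  have 4: "act' h \<one>\<^bsub>C\<^esub> = counit H h \<odot>\<^bsub>C\<^esub> \<one>\<^bsub>C\<^esub>" if "h \<in> carrier H" for h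
    using that by (simp add: pull closed B.act_unit linear)
  show ?thesis
    using 1 2 3 4 unfolding H_algebra_def H_algebra_axioms_def image by blast
qed

context yetter_drinfeld_hom
begin

text \<open>\<open>bar\<close>, \<open>adj\<close>, \<open>diag\<close> and \<open>braid\<close>
  copy \<open>bar_act\<close>, \<open>End_act\<close>, \<open>diag_act\<close> and the product of
  \<open>braided_algebra\<close> literally, with \<open>p\<close> for \<open>oper V actV\<close>, so
  that unfolding alone identifies them in the end.\<close>

definition bar where
  "bar h X = tlift T (\<lambda>a u. sweedler3 T H
     (\<lambda>x y z. t (act y a) (p x \<otimes>\<^bsub>E\<^esub> u \<otimes>\<^bsub>E\<^esub> p (S z))) h) X"

definition adj where
  "adj h u = sweedler2 E H (\<lambda>x y. p x \<otimes>\<^bsub>E\<^esub> u \<otimes>\<^bsub>E\<^esub> p (S y)) h"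

definition diag where
  "diag h X = tlift T (\<lambda>a u. sweedler2 T H (\<lambda>x y. t (act x a) (adj y u)) h) X"

definition braid where
  "braid X Y = tlift T (\<lambda>a u. tlift T (\<lambda>c v. tlift T
     (\<lambda>x y. t (a \<otimes>\<^bsub>A\<^esub> x) (adj y u \<otimes>\<^bsub>E\<^esub> v)) (\<rho> c)) Y) X"

abbreviation bmul where "bmul X Y \<equiv> X \<otimes>\<^bsub>tensor_algebra K A E\<^esub> Y"

lemmas assocs = A.mult_assoc E.mult_assoc H.mult_assoc

lemma T_module [linear]: "module K T"
  by (simp add: linear)

lemmas T_ext = H.tensor_linear_eqI[OF A.is_module E.is_module T_module]

text \<open>\<open>swap\<close> exchanges two sums of the same kind and would loop as a rewrite
  rule, so it is applied by \<open>rule\<close>; \<open>swap'\<close> moves a coaction sum outwards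
  past a coproduct sum and can be used for rewriting.\<close>

lemmas swap = H.tensor_sum_swap[OF H.is_module H.is_module H.is_module H.is_module T_module]
lemmas swap' = H.tensor_sum_swap[OF H.is_module H.is_module A.is_module H.is_module T_module]

lemmas bmul_tens = H.tensor_algebra_mult_tens[OF A.unital_algebra_axioms E.unital_algebra_axioms]
lemmas linear_bmul [linear] =
  H.linear_tensor_algebra_mult'[OF A.unital_algebra_axioms E.unital_algebra_axioms]
lemmas bmul_closed [linear] =
  linear_mapD(1)[OF H.linear_tensor_algebra_mult(1)[OF A.unital_algebra_axioms E.unital_algebra_axioms]]

lemma t_smult:
  assumes "c \<in> carrier K" "a \<in> carrier A" "u \<in> carrier E"
  shows "t (c \<odot>\<^bsub>A\<^esub> a) u = c \<odot>\<^bsub>T\<^esub> t a u" "t a (c \<odot>\<^bsub>E\<^esub> u) = c \<odot>\<^bsub>T\<^esub> t a u"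
  using assms tens_bilinear[OF A.is_module E.is_module]
  by (auto simp: bilinear_map_def linear_map_def)

lemma t_hsum:
  assumes "h \<in> carrier H" "\<And>x y. x \<in> carrier H \<Longrightarrow> y \<in> carrier H \<Longrightarrow> f x y \<in> carrier A" "u \<in> carrier E"
  shows "t (hsum A f h) u = hsum T (\<lambda>x y. t (f x y) u) h"
  by (rule H.tensor_sum_linear[where g = "\<lambda>x. t x u"]) (simp_all add: linear assms)

lemma t_hsum':
  assumes "h \<in> carrier H" "\<And>x y. x \<in> carrier H \<Longrightarrow> y \<in> carrier H \<Longrightarrow> f x y \<in> carrier E" "a \<in> carrier A"
  shows "t a (hsum E f h) = hsum T (\<lambda>x y. t a (f x y)) h"
  by (rule H.tensor_sum_linear[where g = "\<lambda>x. t a x"]) (simp_all add: linear assms)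

text \<open>Right multiplication by \<open>p (S z)\<close> is therefore a left action of
  \<open>H\<close> on \<open>E\<close>, which is what makes \<open>bar\<close> multiplicative in its
  first argument.\<close>

lemma p_antipode_mult:
  "g \<in> carrier H \<Longrightarrow> h \<in> carrier H \<Longrightarrow> p (S (g \<otimes>\<^bsub>H\<^esub> h)) = p (S h) \<otimes>\<^bsub>E\<^esub> p (S g)"
  by (simp add: H.antipode_mult p_mult linear)

lemma hsum_cancel_left:
  assumes "k \<in> carrier H" "a \<in> carrier A" "u \<in> carrier E"
  shows "hsum T (\<lambda>x y. t a (p (S x) \<otimes>\<^bsub>E\<^esub> (p y \<otimes>\<^bsub>E\<^esub> u))) k = counit H k \<odot>\<^bsub>T\<^esub> t a u"
  using H.hsum_antipode_left[OF T_module, where F = "\<lambda>z. t a (p z \<otimes>\<^bsub>E\<^esub> u)"] assms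
  by (simp add: linear p_mult p_one assocs)

lemma hsum_cancel_right:
  assumes "k \<in> carrier H" "a \<in> carrier A" "u \<in> carrier E"
  shows "hsum T (\<lambda>x y. t a (p x \<otimes>\<^bsub>E\<^esub> (p (S y) \<otimes>\<^bsub>E\<^esub> u))) k = counit H k \<odot>\<^bsub>T\<^esub> t a u"
  using H.hsum_antipode_right[OF T_module, where F = "\<lambda>z. t a (p z \<otimes>\<^bsub>E\<^esub> u)"] assms
  by (simp add: linear p_mult p_one assocs)

subsection \<open>The bar action\<close>

text \<open>\<open>sweedler3\<close> splits the first leg a second time; here the second leg is
  split and products are bracketed to the right, the normal form of \<open>hsum_coassoc\<close> and
  \<open>assocs\<close>.\<close>

lemma bar_eq:
  assumes "h \<in> carrier H" "X \<in> carrier T"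
  shows "bar h X = tensor_sum A E T (\<lambda>a u. hsum T (\<lambda>x k. hsum T
    (\<lambda>y z. t (act y a) (p x \<otimes>\<^bsub>E\<^esub> (u \<otimes>\<^bsub>E\<^esub> p (S z)))) k) h) X"
  unfolding bar_def
proof (rule H.tlift_eq_tensor_sum)
  fix a u assume au: "a \<in> carrier A" "u \<in> carrier E"
  have "sweedler3 T H (\<lambda>x y z. t (act y a) (p x \<otimes>\<^bsub>E\<^esub> u \<otimes>\<^bsub>E\<^esub> p (S z))) h =
    hsum T (\<lambda>g z. hsum T (\<lambda>x y. t (act y a) (p x \<otimes>\<^bsub>E\<^esub> (u \<otimes>\<^bsub>E\<^esub> p (S z)))) g) h"
    unfolding sweedler3_def sweedler2_def
    by (intro H.tlift_eq_tensor_sum) (simp_all add: linear assms au assocs)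
  then show "sweedler3 T H (\<lambda>x y z. t (act y a) (p x \<otimes>\<^bsub>E\<^esub> u \<otimes>\<^bsub>E\<^esub> p (S z))) h =
    hsum T (\<lambda>x k. hsum T (\<lambda>y z. t (act y a) (p x \<otimes>\<^bsub>E\<^esub> (u \<otimes>\<^bsub>E\<^esub> p (S z)))) k) h"
    by (simp add: H.hsum_coassoc linear assms au)
qed (simp_all add: linear assms)

lemma bar_tens:
  assumes "h \<in> carrier H" "a \<in> carrier A" "u \<in> carrier E"
  shows "bar h (t a u) =
    hsum T (\<lambda>x k. hsum T (\<lambda>y z. t (act y a) (p x \<otimes>\<^bsub>E\<^esub> (u \<otimes>\<^bsub>E\<^esub> p (S z)))) k) h"
  using assms by (simp add: bar_eq linear H.tensor_sum_tens)

lemma linear_bar: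
  "h \<in> carrier H \<Longrightarrow> linear_map K T T (\<lambda>X. bar h X)"
  "X \<in> carrier T \<Longrightarrow> linear_map K H T (\<lambda>h. bar h X)"
  by (subst linear_map_cong, simp add: linear, erule (1) bar_eq, simp add: linear)+

lemmas linear_bar' [linear] = H.linear_comp[OF linear_bar(1)] H.linear_comp[OF linear_bar(2)]
lemmas bar_closed [linear] = linear_mapD(1)[OF linear_bar(1)]

lemma bar_mult:
  assumes g: "g \<in> carrier H" and h: "h \<in> carrier H" and X: "X \<in> carrier T"
  shows "bar (g \<otimes>\<^bsub>H\<^esub> h) X = bar g (bar h X)"
proof (rule T_ext[where X = X])
  fix a u assume au: "a \<in> carrier A" "u \<in> carrier E"
  let ?F = "\<lambda>x y z x' y' z'. t (act y (act y' a))
    (p x \<otimes>\<^bsub>E\<^esub> (p x' \<otimes>\<^bsub>E\<^esub> (u \<otimes>\<^bsub>E\<^esub> (p (S z') \<otimes>\<^bsub>E\<^esub> p (S z)))))"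
  note simps = linear g h au assocs
  have "bar (g \<otimes>\<^bsub>H\<^esub> h) (t a u) = hsum T (\<lambda>x k. hsum T (\<lambda>x' k'. hsum T (\<lambda>y z. hsum T (\<lambda>y' z'.
      ?F x y z x' y' z') k') k) h) g"
    by (simp add: bar_tens H.hsum_mult p_mult p_antipode_mult A.act_mult simps)
  \<comment> \<open>The legs of \<open>g\<close> and \<open>h\<close> come out interleaved. Three
    interchanges move both sums for \<open>h\<close> outside those for \<open>g\<close>, where the
    inner pair is \<open>bar g\<close> of a pure tensor.\<close>
  also have "\<dots> = hsum T (\<lambda>x k. hsum T (\<lambda>x' k'. hsum T (\<lambda>y' z'. hsum T (\<lambda>y z.
      ?F x y z x' y' z') k) k') h) g"
    by (rule tensor_sum_cong[OF HOL.refl], rule tensor_sum_cong[OF HOL.refl], rule swap) (simp_all add: simps)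
  also have "\<dots> = hsum T (\<lambda>x' k'. hsum T (\<lambda>x k. hsum T (\<lambda>y' z'. hsum T (\<lambda>y z.
      ?F x y z x' y' z') k) k') g) h"
    by (rule swap) (simp_all add: simps)
  also have "\<dots> = hsum T (\<lambda>x' k'. hsum T (\<lambda>y' z'. hsum T (\<lambda>x k. hsum T (\<lambda>y z.
      ?F x y z x' y' z') k) g) k') h"
    by (rule tensor_sum_cong[OF HOL.refl], rule swap) (simp_all add: simps)
  also have "\<dots> = hsum T (\<lambda>x' k'. hsum T (\<lambda>y' z'. bar g (t (act y' a) (p x' \<otimes>\<^bsub>E\<^esub> (u \<otimes>\<^bsub>E\<^esub> p (S z'))))) k') h"
    by (simp add: bar_tens simps)
  also have "\<dots> = bar g (bar h (t a u))"
    by (simp add: bar_tens[of h] simps H.tensor_sum_linear[where g = "bar g" and Q = T])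
  finally show "bar (g \<otimes>\<^bsub>H\<^esub> h) (t a u) = bar g (bar h (t a u))" .
qed (simp_all add: linear assms)

lemma bar_one:
  assumes "X \<in> carrier T"
  shows "bar \<one>\<^bsub>H\<^esub> X = X"
  using _ _ _ assms
  by (rule T_ext) (simp_all add: linear bar_tens H.hsum_one A.act_one p_one H.antipode_one)

text \<open>Acting on the unit of \<open>A\<close> turns the middle leg into a counit; what is left
  is \<open>p(h\<^sub>0) p(S h\<^sub>1)\<close>.\<close>

lemma bar_unit:
  assumes h: "h \<in> carrier H"
  shows "bar h (t \<one>\<^bsub>A\<^esub> \<one>\<^bsub>E\<^esub>) = counit H h \<odot>\<^bsub>T\<^esub> t \<one>\<^bsub>A\<^esub> \<one>\<^bsub>E\<^esub>"
proof -
  have "bar h (t \<one>\<^bsub>A\<^esub> \<one>\<^bsub>E\<^esub>) = hsum T (\<lambda>x k. t \<one>\<^bsub>A\<^esub> (p x \<otimes>\<^bsub>E\<^esub> p (S k))) h"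
    using h by (simp add: bar_tens A.act_unit t_smult linear
        H.hsum_counit_left[where F = "\<lambda>z. t \<one>\<^bsub>A\<^esub> (p x \<otimes>\<^bsub>E\<^esub> p (S z))" for x])
  then show ?thesis
    using hsum_cancel_right[OF h A.unit_closed E.unit_closed] h by (simp add: linear)
qed

text \<open>On pure tensors the right side is \<open>(h\<^sub>1 \<cdot> a)(h\<^sub>4 \<cdot> b)
  \<otimes> p(h\<^sub>0) u p(S h\<^sub>2) p(h\<^sub>3) v p(S h\<^sub>5)\<close>. The inner pair
  cancels, and the legs on \<open>a\<close> and \<open>b\<close> become consecutive, hence those of
  an action on the product of \<open>a\<close> and \<open>b\<close>.\<close>

lemma bar_prod:
  assumes h: "h \<in> carrier H" and X: "X \<in> carrier T" and Y: "Y \<in> carrier T"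
  shows "bar h (bmul X Y) = hsum T (\<lambda>x y. bmul (bar x X) (bar y Y)) h"
proof (rule T_ext[where X = X])
  fix a u assume au: "a \<in> carrier A" "u \<in> carrier E"
  show "bar h (bmul (t a u) Y) = hsum T (\<lambda>x y. bmul (bar x (t a u)) (bar y Y)) h"
  proof (rule T_ext[where X = Y])
    fix b v assume bv: "b \<in> carrier A" "v \<in> carrier E"
    note simps = linear h au bv assocs
    let ?F = "\<lambda>w x y z. hsum T (\<lambda>x' k. hsum T (\<lambda>y' z'. t (act y a \<otimes>\<^bsub>A\<^esub> act y' b)
      (p x \<otimes>\<^bsub>E\<^esub> (u \<otimes>\<^bsub>E\<^esub> (p z \<otimes>\<^bsub>E\<^esub> (p x' \<otimes>\<^bsub>E\<^esub> (v \<otimes>\<^bsub>E\<^esub> p (S z'))))))) k) w"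
    have cancel: "hsum T (\<lambda>z w. hsum T (\<lambda>x' k. hsum T (\<lambda>y' z'. t (c \<otimes>\<^bsub>A\<^esub> act y' b)
        (d \<otimes>\<^bsub>E\<^esub> (u \<otimes>\<^bsub>E\<^esub> (p (S z) \<otimes>\<^bsub>E\<^esub> (p x' \<otimes>\<^bsub>E\<^esub> (v \<otimes>\<^bsub>E\<^esub> p (S z'))))))) k) w) q =
        hsum T (\<lambda>y' z'. t (c \<otimes>\<^bsub>A\<^esub> act y' b) (d \<otimes>\<^bsub>E\<^esub> (u \<otimes>\<^bsub>E\<^esub> (v \<otimes>\<^bsub>E\<^esub> p (S z'))))) q"
      (is "?L = _")
      if cdq: "c \<in> carrier A" "d \<in> carrier E" "q \<in> carrier H" for c d q
    proof -
      \<comment> \<open>\<open>G k z\<close> keeps the legs that follow \<open>x'\<close> summed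
        over \<open>k\<close> and leaves a slot \<open>z\<close> for the product of
        \<open>S z\<close> and \<open>x'\<close>, so that the antipode rule applies to one linear
        function.\<close>
      define G where "G k z = hsum T (\<lambda>y' z'. t (c \<otimes>\<^bsub>A\<^esub> act y' b)
        (d \<otimes>\<^bsub>E\<^esub> (u \<otimes>\<^bsub>E\<^esub> (p z \<otimes>\<^bsub>E\<^esub> (v \<otimes>\<^bsub>E\<^esub> p (S z')))))) k" for k z
      have G: "linear_map K H T (\<lambda>z. G k z)" "linear_map K H T (\<lambda>z. G z k)" if "k \<in> carrier H" for k
        unfolding G_def using that cdq by (simp_all add: simps)
      have "?L = hsum T (\<lambda>n k. hsum T (\<lambda>z x'. G k (S z \<otimes>\<^bsub>H\<^esub> x')) n) q"
        unfolding G_def using cdq by (simp add: H.hsum_coassoc p_mult simps)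
      also have "\<dots> = hsum T (\<lambda>n k. counit H n \<odot>\<^bsub>T\<^esub> G k \<one>\<^bsub>H\<^esub>) q"
        by (simp add: H.hsum_antipode_left G linear)
      also have "\<dots> = G q \<one>\<^bsub>H\<^esub>"
        by (rule H.hsum_counit_left) (simp_all add: linear G cdq)
      finally show ?thesis by (simp add: G_def p_one simps cdq)
    qed
    have "hsum T (\<lambda>x y. bmul (bar x (t a u)) (bar y (t b v))) h =
      hsum T (\<lambda>r s. hsum T (\<lambda>x k. hsum T (\<lambda>y z.
        bmul (t (act y a) (p x \<otimes>\<^bsub>E\<^esub> (u \<otimes>\<^bsub>E\<^esub> p (S z)))) (bar s (t b v))) k) r) h"
      by (simp add: bar_tens[of _ a u] simps
          H.tensor_sum_linear[where g = "\<lambda>X. bmul X Y" and Q = T for Y])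
    also have "\<dots> = hsum T (\<lambda>r s. hsum T (\<lambda>x k. hsum T (\<lambda>y z. ?F s x y (S z)) k) r) h"
      by (simp add: bar_tens[of _ b v] simps bmul_tens
          H.tensor_sum_linear[where g = "\<lambda>X. bmul Y X" and Q = T for Y])
    also have "\<dots> = hsum T (\<lambda>x k. hsum T (\<lambda>y w. hsum T (\<lambda>z s. ?F s x y (S z)) w) k) h"
      by (simp add: H.hsum_coassoc simps)
    also have "\<dots> = hsum T (\<lambda>x k. hsum T (\<lambda>y w. hsum T (\<lambda>y' z'. t (act y a \<otimes>\<^bsub>A\<^esub> act y' b)
        (p x \<otimes>\<^bsub>E\<^esub> (u \<otimes>\<^bsub>E\<^esub> (v \<otimes>\<^bsub>E\<^esub> p (S z'))))) w) k) h"
      by (simp add: cancel simps)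
    also have "\<dots> = hsum T (\<lambda>x k. hsum T (\<lambda>y z. t (act y (a \<otimes>\<^bsub>A\<^esub> b))
        (p x \<otimes>\<^bsub>E\<^esub> (u \<otimes>\<^bsub>E\<^esub> (v \<otimes>\<^bsub>E\<^esub> p (S z))))) k) h"
      by (simp add: act_prod_hsum t_hsum H.hsum_coassoc simps)
    also have "\<dots> = bar h (bmul (t a u) (t b v))"
      by (simp add: bmul_tens bar_tens simps)
    finally show "bar h (bmul (t a u) (t b v)) =
      hsum T (\<lambda>x y. bmul (bar x (t a u)) (bar y (t b v))) h" ..
  qed (simp_all add: linear h au Y)
qed (simp_all add: linear h X Y)

lemma bar_H_algebra: "H_algebra K H (tensor_algebra K A E) bar"
proof -
  let ?B = "tensor_algebra K A E"
  have B: "unital_algebra K ?B"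
    by (rule H.tensor_algebra_unital) unfold_locales
  then have "module K ?B" by (simp add: unital_algebra_def)
  moreover have "bilinear_map K H ?B ?B bar"
    using linear_bar by (simp add: bilinear_map_def tensor_algebra_def)
  moreover have "carrier ?B = carrier T" "\<one>\<^bsub>?B\<^esub> = t \<one>\<^bsub>A\<^esub> \<one>\<^bsub>E\<^esub>" "smult ?B = smult T"
    by (simp_all add: tensor_algebra_def)
  \<comment> \<open>A lift uses only the addition and the zero of its target, and these the algebra
    shares with \<open>T\<close>.\<close>
  moreover have "sweedler2 ?B H f h = hsum T f h" if "h \<in> carrier H" for f h
    using that unfolding sweedler2_def
    by (simp add: H.tensor_sum_eq_tlift linear tlift_def tensor_algebra_def)
  ultimately show ?thesis
    using B by (simp add: H_algebra_def H_algebra_axioms_def representation_def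
        representation_axioms_def bar_mult bar_one bar_prod bar_unit)
qed


subsection \<open>The braided product and the diagonal action\<close>

lemma adj_eq:
  assumes "h \<in> carrier H" "u \<in> carrier E"
  shows "adj h u = hsum E (\<lambda>x y. p x \<otimes>\<^bsub>E\<^esub> (u \<otimes>\<^bsub>E\<^esub> p (S y))) h"
  unfolding adj_def sweedler2_def
  by (intro H.tlift_eq_tensor_sum) (simp_all add: linear assms assocs)

lemma adj_closed [linear]: "h \<in> carrier H \<Longrightarrow> u \<in> carrier E \<Longrightarrow> adj h u \<in> carrier E"
  by (simp add: adj_eq linear)

lemma linear_adj:
  "h \<in> carrier H \<Longrightarrow> linear_map K E E (\<lambda>u. adj h u)"
  "u \<in> carrier E \<Longrightarrow> linear_map K H E (\<lambda>h. adj h u)"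
  by (subst linear_map_cong, simp add: linear, erule (1) adj_eq, simp add: linear)+

lemmas linear_adj' [linear] = H.linear_comp[OF linear_adj(1)] H.linear_comp[OF linear_adj(2)]

lemma braid_eq:
  assumes "X \<in> carrier T" "Y \<in> carrier T"
  shows "braid X Y = tensor_sum A E T (\<lambda>a u. tensor_sum A E T (\<lambda>c v. csum T
     (\<lambda>x y. t (a \<otimes>\<^bsub>A\<^esub> x) (adj y u \<otimes>\<^bsub>E\<^esub> v)) c) Y) X"
  unfolding braid_def by (intro H.tlift_eq_tensor_sum) (simp_all add: linear assms)

lemma braid_tens:
  assumes "a \<in> carrier A" "u \<in> carrier E" "c \<in> carrier A" "v \<in> carrier E"
  shows "braid (t a u) (t c v) = csum T (\<lambda>x y. t (a \<otimes>\<^bsub>A\<^esub> x) (adj y u \<otimes>\<^bsub>E\<^esub> v)) c"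
  using assms by (simp add: braid_eq linear H.tensor_sum_tens)

lemma linear_braid:
  "X \<in> carrier T \<Longrightarrow> linear_map K T T (\<lambda>Y. braid X Y)"
  "Y \<in> carrier T \<Longrightarrow> linear_map K T T (\<lambda>X. braid X Y)"
  by (subst linear_map_cong, simp add: linear, erule (1) braid_eq, simp add: linear)+

lemmas linear_braid' [linear] = H.linear_comp[OF linear_braid(1)] H.linear_comp[OF linear_braid(2)]

lemma diag_eq:
  assumes "h \<in> carrier H" "X \<in> carrier T"
  shows "diag h X = tensor_sum A E T (\<lambda>a u. hsum T (\<lambda>x y. t (act x a) (adj y u)) h) X"
  unfolding diag_def sweedler2_def
  by (intro H.tlift_eq_tensor_sum) (simp_all add: linear assms)

lemma diag_tens:
  assumes "h \<in> carrier H" "a \<in> carrier A" "u \<in> carrier E"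
  shows "diag h (t a u) =
    hsum T (\<lambda>x k. hsum T (\<lambda>y z. t (act x a) (p y \<otimes>\<^bsub>E\<^esub> (u \<otimes>\<^bsub>E\<^esub> p (S z)))) k) h"
  using assms by (simp add: diag_eq linear H.tensor_sum_tens) (simp add: adj_eq t_hsum' linear)

lemma linear_diag: "h \<in> carrier H \<Longrightarrow> linear_map K T T (\<lambda>X. diag h X)"
  by (subst linear_map_cong, simp add: linear, erule (1) diag_eq, simp add: linear)

lemmas linear_diag' [linear] = H.linear_comp[OF linear_diag]

subsection \<open>The isomorphism\<close>

definition \<Phi> where
  "\<Phi> X = tensor_sum A E T (\<lambda>a u. csum T (\<lambda>x y. t x (p y \<otimes>\<^bsub>E\<^esub> u)) a) X"

definition \<Psi> where
  "\<Psi> X = tensor_sum A E T (\<lambda>a u. csum T (\<lambda>x y. t x (p (S y) \<otimes>\<^bsub>E\<^esub> u)) a) X"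

lemma \<Phi>_tens:
  "a \<in> carrier A \<Longrightarrow> u \<in> carrier E \<Longrightarrow> \<Phi> (t a u) = csum T (\<lambda>x y. t x (p y \<otimes>\<^bsub>E\<^esub> u)) a"
  by (simp add: \<Phi>_def linear H.tensor_sum_tens)

lemma \<Psi>_tens:
  "a \<in> carrier A \<Longrightarrow> u \<in> carrier E \<Longrightarrow> \<Psi> (t a u) = csum T (\<lambda>x y. t x (p (S y) \<otimes>\<^bsub>E\<^esub> u)) a"
  by (simp add: \<Psi>_def linear H.tensor_sum_tens)

lemma linear_\<Phi>: "linear_map K T T (\<lambda>X. \<Phi> X)"
  unfolding \<Phi>_def by (simp add: linear)

lemma linear_\<Psi>: "linear_map K T T (\<lambda>X. \<Psi> X)"
  unfolding \<Psi>_def by (simp add: linear)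

lemmas linear_\<Phi>' [linear] = H.linear_comp[OF linear_\<Phi>] H.linear_comp[OF linear_\<Psi>]
lemmas \<Phi>_closed [linear] = linear_mapD(1)[OF linear_\<Phi>] linear_mapD(1)[OF linear_\<Psi>]

lemmas pull_\<Phi> = H.tensor_sum_linear[OF _ _ _ T_module linear_\<Phi>] H.tensor_sum_linear[OF _ _ _ T_module linear_\<Psi>]

text \<open>The composite is \<open>a\<^sub>0 \<otimes> p(S a\<^sub>1) p(a\<^sub>2) u\<close>,
  collapsed by the left antipode identity and the counit; the other composite has
  \<open>p(a\<^sub>1) p(S a\<^sub>2)\<close> and needs the right one.\<close>

lemma \<Psi>_\<Phi>:
  assumes X: "X \<in> carrier T"
  shows "\<Psi> (\<Phi> X) = X"
proof (rule T_ext[where X = X])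
  fix a u assume au: "a \<in> carrier A" "u \<in> carrier E"
  have "\<Psi> (\<Phi> (t a u)) = csum T (\<lambda>b z. csum T (\<lambda>x y. t x (p (S y) \<otimes>\<^bsub>E\<^esub> (p z \<otimes>\<^bsub>E\<^esub> u))) b) a"
    using au by (simp add: \<Phi>_tens \<Psi>_tens pull_\<Phi> linear)
  also have "\<dots> = csum T (\<lambda>x k. counit H k \<odot>\<^bsub>T\<^esub> t x u) a"
    using au by (simp add: csum_coassoc linear hsum_cancel_left)
  also have "\<dots> = t a u"
    using au by (simp add: linear csum_counit[where F = "\<lambda>x. t x u"])
  finally show "\<Psi> (\<Phi> (t a u)) = t a u" .
qed (simp_all add: linear X)

lemma \<Phi>_\<Psi>:
  assumes X: "X \<in> carrier T"
  shows "\<Phi> (\<Psi> X) = X"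
proof (rule T_ext[where X = X])
  fix a u assume au: "a \<in> carrier A" "u \<in> carrier E"
  have "\<Phi> (\<Psi> (t a u)) = csum T (\<lambda>b z. csum T (\<lambda>x y. t x (p y \<otimes>\<^bsub>E\<^esub> (p (S z) \<otimes>\<^bsub>E\<^esub> u))) b) a"
    using au by (simp add: \<Phi>_tens \<Psi>_tens pull_\<Phi> linear)
  also have "\<dots> = csum T (\<lambda>x k. counit H k \<odot>\<^bsub>T\<^esub> t x u) a"
    using au by (simp add: csum_coassoc linear hsum_cancel_right)
  also have "\<dots> = t a u"
    using au by (simp add: linear csum_counit[where F = "\<lambda>x. t x u"])
  finally show "\<Phi> (\<Psi> (t a u)) = t a u" .
qed (simp_all add: linear X)

lemma \<Phi>_bij: "bij_betw \<Phi> (carrier T) (carrier T)"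
  by (rule bij_betw_byWitness[where f' = \<Psi>]) (auto simp: \<Psi>_\<Phi> \<Phi>_\<Psi> linear)

lemma \<Phi>_one: "\<Phi> (t \<one>\<^bsub>A\<^esub> \<one>\<^bsub>E\<^esub>) = t \<one>\<^bsub>A\<^esub> \<one>\<^bsub>E\<^esub>"
  by (simp add: \<Phi>_tens linear csum_one p_one)

lemma \<Phi>_mult:
  assumes X: "X \<in> carrier T" and Y: "Y \<in> carrier T"
  shows "\<Phi> (bmul X Y) = braid (\<Phi> X) (\<Phi> Y)"
proof (rule T_ext[where X = X])
  fix a u assume au: "a \<in> carrier A" "u \<in> carrier E"
  show "\<Phi> (bmul (t a u) Y) = braid (\<Phi> (t a u)) (\<Phi> Y)"
  proof (rule T_ext[where X = Y])
    fix c v assume cv: "c \<in> carrier A" "v \<in> carrier E"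
    note simps = linear au cv assocs
    \<comment> \<open>That the action on \<open>E\<close> is inner: conjugating \<open>w\<close> by
      the first leg of \<open>k\<close> and multiplying by the second on the right is multiplying
      \<open>w\<close> by \<open>p k\<close> on the left.\<close>
    have cancel: "hsum T (\<lambda>y z. t d (adj y w \<otimes>\<^bsub>E\<^esub> (p z \<otimes>\<^bsub>E\<^esub> v))) k = t d (p k \<otimes>\<^bsub>E\<^esub> (w \<otimes>\<^bsub>E\<^esub> v))"
      if dwk: "d \<in> carrier A" "w \<in> carrier E" "k \<in> carrier H" for d w k
    proof -
      have "hsum T (\<lambda>y z. t d (adj y w \<otimes>\<^bsub>E\<^esub> (p z \<otimes>\<^bsub>E\<^esub> v))) k =
        hsum T (\<lambda>n z. hsum T (\<lambda>x y. t d (p x \<otimes>\<^bsub>E\<^esub> (w \<otimes>\<^bsub>E\<^esub> (p (S y) \<otimes>\<^bsub>E\<^esub> (p z \<otimes>\<^bsub>E\<^esub> v))))) n) k"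
        using dwk by (simp add: adj_eq simps t_hsum'
          H.tensor_sum_linear[where g = "\<lambda>X. X \<otimes>\<^bsub>E\<^esub> Y" and Q = E for Y])
      also have "\<dots> = hsum T (\<lambda>x n. hsum T (\<lambda>y z. t d (p x \<otimes>\<^bsub>E\<^esub> (w \<otimes>\<^bsub>E\<^esub> (p (S y \<otimes>\<^bsub>H\<^esub> z) \<otimes>\<^bsub>E\<^esub> v)))) n) k"
        using dwk by (simp add: H.hsum_coassoc p_mult simps)
      also have "\<dots> = hsum T (\<lambda>x n. counit H n \<odot>\<^bsub>T\<^esub> t d (p x \<otimes>\<^bsub>E\<^esub> (w \<otimes>\<^bsub>E\<^esub> v))) k"
        using dwk by (simp add: simps p_one
          H.hsum_antipode_left[where F = "\<lambda>y. t d (p x \<otimes>\<^bsub>E\<^esub> (w \<otimes>\<^bsub>E\<^esub> (p y \<otimes>\<^bsub>E\<^esub> v)))" for x])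
      also have "\<dots> = t d (p k \<otimes>\<^bsub>E\<^esub> (w \<otimes>\<^bsub>E\<^esub> v))"
        using dwk by (simp add: simps H.hsum_counit_right[where F = "\<lambda>x. t d (p x \<otimes>\<^bsub>E\<^esub> (w \<otimes>\<^bsub>E\<^esub> v))"])
      finally show ?thesis .
    qed
    have "braid (\<Phi> (t a u)) (\<Phi> (t c v)) =
      csum T (\<lambda>x y. csum T (\<lambda>x' y'. braid (t x (p y \<otimes>\<^bsub>E\<^esub> u)) (t x' (p y' \<otimes>\<^bsub>E\<^esub> v))) c) a"
      by (simp add: \<Phi>_tens[of a u] simps
          H.tensor_sum_linear[where g = "\<lambda>X. braid X Y" and Q = T for Y])
        (simp add: \<Phi>_tens[of c v] simps
          H.tensor_sum_linear[where g = "\<lambda>X. braid Y X" and Q = T for Y])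
    \<comment> \<open>The component of \<open>c\<close> is needed twice, once to act in the braided
      product and once under \<open>p\<close>; coassociativity makes the two uses legs of one
      coproduct.\<close>
    also have "\<dots> = csum T (\<lambda>x y. csum T (\<lambda>x' k. hsum T (\<lambda>y' z.
        t (x \<otimes>\<^bsub>A\<^esub> x') (adj y' (p y \<otimes>\<^bsub>E\<^esub> u) \<otimes>\<^bsub>E\<^esub> (p z \<otimes>\<^bsub>E\<^esub> v))) k) c) a"
      by (simp add: braid_tens simps csum_coassoc)
    also have "\<dots> = csum T (\<lambda>x y. csum T (\<lambda>x' k. t (x \<otimes>\<^bsub>A\<^esub> x') (p (k \<otimes>\<^bsub>H\<^esub> y) \<otimes>\<^bsub>E\<^esub> (u \<otimes>\<^bsub>E\<^esub> v))) c) a"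
      by (simp add: cancel simps p_mult)
    also have "\<dots> = \<Phi> (bmul (t a u) (t c v))"
      by (simp add: bmul_tens \<Phi>_tens csum_mult simps)
    finally show "\<Phi> (bmul (t a u) (t c v)) = braid (\<Phi> (t a u)) (\<Phi> (t c v))" ..
  qed (simp_all add: linear au Y)
qed (simp_all add: linear X Y)

text \<open>The bar action uses \<open>h\<^sub>1\<close> on \<open>A\<close> and
  \<open>h\<^sub>0\<close> on \<open>E\<close>, so \<Phi> produces \<open>(h\<^sub>1 \<cdot>
  a)\<^sub>0 \<otimes> p((h\<^sub>1 \<cdot> a)\<^sub>1 h\<^sub>0) u p(S h\<^sub>2)\<close>, one side
  of the Yetter-Drinfeld condition. The other side, \<open>h\<^sub>0 \<cdot> a\<^sub>0 \<otimes>
  p(h\<^sub>1 a\<^sub>1) u p(S h\<^sub>2)\<close>, is the diagonal action.\<close>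

lemma \<Phi>_act:
  assumes h: "h \<in> carrier H" and X: "X \<in> carrier T"
  shows "\<Phi> (bar h X) = diag h (\<Phi> X)"
proof (rule T_ext[where X = X])
  fix a u assume au: "a \<in> carrier A" "u \<in> carrier E"
  note simps = linear au h assocs
  have "\<Phi> (bar h (t a u)) = hsum T (\<lambda>x k. hsum T (\<lambda>y z. csum T (\<lambda>b c.
      t b (p (c \<otimes>\<^bsub>H\<^esub> x) \<otimes>\<^bsub>E\<^esub> (u \<otimes>\<^bsub>E\<^esub> p (S z)))) (act y a)) k) h"
    by (simp add: bar_tens \<Phi>_tens pull_\<Phi> p_mult simps)
  \<comment> \<open>The condition speaks of the two legs of a single element, so the first two legs
    of \<open>h\<close> are gathered in \<open>k\<close>.\<close>
  also have "\<dots> = hsum T (\<lambda>k z. hsum T (\<lambda>x y. csum T (\<lambda>b c.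
      t b (p (c \<otimes>\<^bsub>H\<^esub> x) \<otimes>\<^bsub>E\<^esub> (u \<otimes>\<^bsub>E\<^esub> p (S z)))) (act y a)) k) h"
    by (simp add: H.hsum_coassoc simps)
  also have "\<dots> = hsum T (\<lambda>k z. hsum T (\<lambda>x y. csum T (\<lambda>b c.
      t (act x b) (p (y \<otimes>\<^bsub>H\<^esub> c) \<otimes>\<^bsub>E\<^esub> (u \<otimes>\<^bsub>E\<^esub> p (S z)))) a) k) h"
    by (rule tensor_sum_cong[OF HOL.refl], rule hsum_csum_yetter_drinfeld) (simp_all add: simps)
  also have "\<dots> = hsum T (\<lambda>x k. hsum T (\<lambda>y z. csum T (\<lambda>b c.
      t (act x b) (p y \<otimes>\<^bsub>E\<^esub> (p c \<otimes>\<^bsub>E\<^esub> (u \<otimes>\<^bsub>E\<^esub> p (S z))))) a) k) h"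
    by (simp add: H.hsum_coassoc simps p_mult)
  also have "\<dots> = csum T (\<lambda>b c. hsum T (\<lambda>x k. hsum T (\<lambda>y z.
      t (act x b) (p y \<otimes>\<^bsub>E\<^esub> (p c \<otimes>\<^bsub>E\<^esub> (u \<otimes>\<^bsub>E\<^esub> p (S z))))) k) h) a"
    by (simp add: swap'[where Y = "\<rho> a"] simps)
  also have "\<dots> = diag h (\<Phi> (t a u))"
    by (simp add: \<Phi>_tens simps H.tensor_sum_linear[where g = "\<lambda>X. diag h X" and Q = T] diag_tens)
  finally show "\<Phi> (bar h (t a u)) = diag h (\<Phi> (t a u))" .
qed (simp_all add: linear h X)

lemma H_algebra_iso_\<Phi>:
  defines "C \<equiv> T\<lparr>mult := braid, one := t \<one>\<^bsub>A\<^esub> \<one>\<^bsub>E\<^esub>\<rparr>"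
  shows "H_algebra K H C diag" "\<Phi> \<in> H_algebra_iso K H (tensor_algebra K A E) bar C diag"
proof -
  let ?B = "tensor_algebra K A E"
  have B: "carrier ?B = carrier T" "\<one>\<^bsub>?B\<^esub> = t \<one>\<^bsub>A\<^esub> \<one>\<^bsub>E\<^esub>" "add ?B = add T"
    by (simp_all add: tensor_algebra_def)
  have lin: "linear_map K ?B C \<Phi>"
    using linear_\<Phi> by (simp add: C_def tensor_algebra_def)
  show "H_algebra K H C diag"
  proof (rule H.H_algebra_transport[OF bar_H_algebra _ lin])
    show "module K C" unfolding C_def by (rule module_update[OF T_module])
    show "\<Phi> ` carrier ?B = carrier C"
      using bij_betw_imp_surj_on[OF \<Phi>_bij] by (simp add: B C_def)
  qed (simp_all add: B C_def \<Phi>_mult \<Phi>_one \<Phi>_act)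
  have "\<Phi> \<in> ring_iso ?B C"
    using \<Phi>_bij linear_mapD[OF linear_\<Phi>]
    by (auto simp: ring_iso_def ring_hom_def B C_def \<Phi>_mult \<Phi>_one)
  then show "\<Phi> \<in> H_algebra_iso K H ?B bar C diag"
    using lin by (simp add: H_algebra_iso_def algebra_iso_def B \<Phi>_act)
qed

end

text \<open>A representation amounts to an algebra homomorphism into the endomorphisms;
  \<open>oper\<close> cuts each operator down to the carrier, where equality of extensional
  functions is decided.\<close>

lemma yetter_drinfeld_hom_oper:
  assumes "hopf_algebra K H" "yetter_drinfeld_algebra K H A actA \<rho>" "representation K H V actV"
  shows "yetter_drinfeld_hom K H A actA \<rho> (End_algebra K V) (oper V actV)"
proof -
  interpret H: hopf_algebra K H by fact
  interpret V: representation K H V actV by fact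
  have act: "linear_map K V V (actV h)" if "h \<in> carrier H" for h
    using that V.act_bilinear by (simp add: bilinear_map_def)
  have act': "linear_map K H V (\<lambda>h. actV h v)" if "v \<in> carrier V" for v
    using that V.act_bilinear by (simp add: bilinear_map_def)
  have "linear_map K H (End_algebra K V) (oper V actV)"
  proof (rule linear_mapI)
    fix h assume h: "h \<in> carrier H"
    have "linear_map K V V (oper V actV h)"
      using act[OF h] linear_map_cong[OF V.module_axioms, of "oper V actV h" "actV h" V]
      by (simp add: oper_def)
    then show "oper V actV h \<in> carrier (End_algebra K V)"
      by (simp add: End_algebra_def oper_def)
  qed (auto simp: End_algebra_def oper_def linear_mapD[OF act'] intro!: ext)
  moreover have "oper V actV (g \<otimes>\<^bsub>H\<^esub> h) = oper V actV g \<otimes>\<^bsub>End_algebra K V\<^esub> oper V actV h"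
    if "g \<in> carrier H" "h \<in> carrier H" for g h
    using that by (auto simp: End_algebra_def oper_def compose_def V.act_mult linear_mapD(1)[OF act] intro!: ext)
  moreover have "oper V actV \<one>\<^bsub>H\<^esub> = \<one>\<^bsub>End_algebra K V\<^esub>"
    by (auto simp: End_algebra_def oper_def V.act_one intro!: ext)
  ultimately show ?thesis
    using assms End_unital_algebra[OF V.module_axioms]
    by (simp add: yetter_drinfeld_hom_def yetter_drinfeld_hom_axioms_def)
qed

theorem proposition6p1:
  fixes K :: "'k ring"
    and H :: "('k, 'h) hopf"
    and A :: "('k, 'a) module" and actA :: "'h \<Rightarrow> 'a \<Rightarrow> 'a" and \<rho> :: "'a \<Rightarrow> ('a \<times> 'h) list set"
    and V :: "('k, 'v) module" and actV :: "'h \<Rightarrow> 'v \<Rightarrow> 'v"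
  assumes "field K"
    and "\<forall>n::nat. n > 0 \<longrightarrow> [n] \<cdot>\<^bsub>K\<^esub> \<one>\<^bsub>K\<^esub> \<noteq> \<zero>\<^bsub>K\<^esub>"
    and "hopf_algebra K H"
    and "bij_betw (antipode H) (carrier H) (carrier H)"
    and "yetter_drinfeld_algebra K H A actA \<rho>"
    and "representation K H V actV"
  shows "H_algebra K H (tensor_algebra K A (End_algebra K V)) (bar_act K H A actA V actV) \<and>
    H_algebra K H (braided_algebra K H A \<rho> V actV) (diag_act K H A actA V actV) \<and>
    (\<exists>\<Phi>. \<Phi> \<in> H_algebra_iso K H
       (tensor_algebra K A (End_algebra K V)) (bar_act K H A actA V actV)
       (braided_algebra K H A \<rho> V actV) (diag_act K H A actA V actV))"
proof -
  interpret yetter_drinfeld_hom K H A actA \<rho> "End_algebra K V" "oper V actV"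
    using assms by (intro yetter_drinfeld_hom_oper)
  have adj: "End_act K H V actV = adj"
    by (intro ext) (simp add: End_act_def adj_def)
  have bar: "bar_act K H A actA V actV = bar"
    by (intro ext) (simp add: bar_act_def bar_def Let_def)
  have diag: "diag_act K H A actA V actV = diag"
    by (intro ext) (simp add: diag_act_def diag_def Let_def adj)
  have braid: "braided_algebra K H A \<rho> V actV = T\<lparr>mult := braid, one := t \<one>\<^bsub>A\<^esub> \<one>\<^bsub>End_algebra K V\<^esub>\<rparr>"
    by (simp add: braided_algebra_def braid_def[abs_def] Let_def adj)
  show ?thesis
    unfolding bar diag braid using bar_H_algebra H_algebra_iso_\<Phi> by blast
qed

end
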